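(* Let $\mathcal{E}\subset B(H)$ be a symmetric operator ideal and let $\psi:\mathbb{R}_+\to\mathbb{R}_+$ be a concave increasing function with $\mathcal{M}_\psi\subset\mathcal{E}$. Let $\omega$ be a dilation invariant singular state on the algebra $l_\infty$ such that the mapping $$\tau_\omega(A)=\omega\left(\left\{\frac1{\psi(n+1)}\sum_{k=0}^n\mu(k,A)\right\}_{n\ge0}\right),\quad A\in\mathcal{E}_+,$$ is finite on $\mathcal{E}_+$. Then $\tau_\omega$ is additive on $\mathcal{E}_+$ if and only if $$\omega\left(\left\{\frac{\psi(2n+1)}{\psi(n+1)}\right\}_{n\ge0}\right)=1.$$
   Context: $H$ is an infinite-dimensional separable complex Hilbert space, $B(H)$ the bounded operators on $H$. For $A\in B(H)$, $\mu(t,A)=\inf\{\|Ap\|: p \text{ a projection},\ \mathrm{Tr}(1-p)\le t\}$; this step function is identified with the decreasing sequence $\{\mu(k,A)\}_{k\ge0}$ (the singular values of $A$, with multiplicity, when $A$ is compact). A symmetric operator ideal is a two-sided ideal $\mathcal{E}$ of $B(H)$ with a complete norm $\|\cdot\|_{\mathcal{E}}$ such that $\|AB\|_{\mathcal{E}}\le\|A\|_{\mathcal{E}}\|B\|$ and $\|BA\|_{\mathcal{E}}\le\|A\|_{\mathcal{E}}\|B\|$ for $A\in\mathcal{E}$, $B\in B(H)$. $\mathcal{E}_+$ is the cone of positive operators in $\mathcal{E}$. For a concave increasing (non-decreasing) $\psi:\mathbb{R}_+\to\mathbb{R}_+$ with $\psi(t)>0$ for $t>0$, the Marcinkiewicz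 ideal is $\mathcal{M}_\psi=\{A\in B(H):\sup_{n\ge0}\frac1{\psi(n+1)}\sum_{k=0}^n\mu(k,A)<\infty\}$. A state on $l_\infty$ (bounded sequences indexed by $\{0,1,2,\dots\}$) is a positive linear functional $\omega$ with $\omega(1)=1$. It is singular if it vanishes on finitely supported sequences, and dilation invariant if $\omega\circ\sigma_n=\omega$ for all $n\in\mathbb{N}$, where $\sigma_n(a_0,a_1,\dots)=(a_0,\dots,a_0,a_1,\dots,a_1,\dots)$ repeats each entry $n$ times. Every state $\omega$ is extended to all (possibly unbounded) nonnegative sequences $x$ by $\omega(x)=\sup\{\omega(y):0\le y\le x,\ y\in l_\infty\}\in[0,\infty]$; this extension is used in the definition of $\tau_\omega$. (The sequence $\psi(2n+1)/\psi(n+1)$ is bounded.) *)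

theory Defs
  imports "HOL-Analysis.Analysis" "HOL-Library.Nonpos_Ints"
begin

section \<open>Complex Hilbert spaces\<close>

text \<open>A complex Hilbert space, presented on top of its underlying real Hilbert space: the real inner
  product is the real part of the complex one, so the norm is the usual Hilbert space norm.
  The complex inner product is linear in its first argument.\<close>

class complex_hilbert_space = real_inner + complete_space +
  fixes scaleC :: "complex \<Rightarrow> 'a \<Rightarrow> 'a"
    and cinner :: "'a \<Rightarrow> 'a \<Rightarrow> complex"
  assumes scaleC_add_right: "scaleC c (x + y) = scaleC c x + scaleC c y"
    and scaleC_add_left: "scaleC (c + d) x = scaleC c x + scaleC d x"
    and scaleC_scaleC: "scaleC c (scaleC d x) = scaleC (c * d) x"
    and scaleC_of_real: "scaleC (complex_of_real r) x = scaleR r x"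
    and cinner_commute: "cinner x y = cnj (cinner y x)"
    and cinner_add_left: "cinner (x + y) z = cinner x z + cinner y z"
    and cinner_scaleC_left: "cinner (scaleC c x) y = c * cinner x y"
    and Re_cinner: "Re (cinner x y) = inner x y"

lemma vector_space_scaleC:
  "vector_space (scaleC :: complex \<Rightarrow> 'a \<Rightarrow> 'a::complex_hilbert_space)"
proof
  show "scaleC 1 x = x" for x :: 'a
    using scaleC_of_real[of 1 x] by simp
qed (simp_all add: scaleC_add_right scaleC_add_left scaleC_scaleC)

lemma cinner_self: "cinner x x = complex_of_real ((norm x)\<^sup>2)"
proof (rule complex_eqI)
  show "Im (cinner x x) = Im (complex_of_real ((norm x)\<^sup>2))"
    using arg_cong[OF cinner_commute[of x x], of Im] by simp
qed (simp add: Re_cinner power2_norm_eq_inner)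

lemma norm_scaleC: "norm (scaleC c x) = cmod c * norm x"
proof -
  have "cinner (scaleC c x) (scaleC c x) = c * cnj c * cinner x x"
    by (metis (no_types, lifting) cinner_commute cinner_scaleC_left complex_cnj_cnj
        complex_cnj_mult mult.assoc)
  then have "complex_of_real ((norm (scaleC c x))\<^sup>2) = complex_of_real ((cmod c * norm x)\<^sup>2)"
    by (simp only: cinner_self complex_norm_square[symmetric] power_mult_distrib of_real_mult)
  then have "(norm (scaleC c x))\<^sup>2 = (cmod c * norm x)\<^sup>2"
    by (simp only: of_real_eq_iff)
  then show ?thesis
    by (simp add: power2_eq_iff_nonneg)
qed

definition separable :: "'a::topological_space itself \<Rightarrow> bool" where
  "separable _ \<longleftrightarrow> (\<exists>D :: 'a set. countable D \<and> closure D = UNIV)"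

definition infinite_dimensional :: "'a::complex_hilbert_space itself \<Rightarrow> bool" where
  "infinite_dimensional _ \<longleftrightarrow> \<not> (\<exists>B :: 'a set. finite B \<and> module.span scaleC B = UNIV)"

definition orthonormal_basis :: "'a::complex_hilbert_space set \<Rightarrow> bool" where
  "orthonormal_basis B \<longleftrightarrow>
     (\<forall>e\<in>B. \<forall>f\<in>B. cinner e f = (if e = f then 1 else 0)) \<and> closure (module.span scaleC B) = UNIV"

section \<open>Bounded operators and singular values\<close>

text \<open>The library type of bounded operators consists of real-linear maps; \<open>bounded_ops\<close> is the
  algebra of the complex-linear ones. Its operator norm is \<^term>\<open>norm\<close>.\<close>

type_synonym 'a oper = "'a \<Rightarrow>\<^sub>L 'a"

definition bounded_ops :: "('a::complex_hilbert_space) oper set" where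
  "bounded_ops = {A. \<forall>c x. blinfun_apply A (scaleC c x) = scaleC c (blinfun_apply A x)}"

definition scale_op :: "complex \<Rightarrow> ('a::complex_hilbert_space) oper \<Rightarrow> 'a oper" where
  "scale_op c A = Blinfun (\<lambda>x. scaleC c (blinfun_apply A x))"

lemma scale_op_apply: "blinfun_apply (scale_op c A) x = scaleC c (blinfun_apply A x)"
proof -
  have comm: "scaleC c (scaleR r y) = scaleR r (scaleC c y)" for r and y :: 'a
    using scaleC_scaleC[of c "complex_of_real r" y] scaleC_scaleC[of "complex_of_real r" c y]
    by (simp add: scaleC_of_real mult.commute)
  have "bounded_linear (\<lambda>y :: 'a. scaleC c y)"
    by (rule bounded_linear_intro[of _ "cmod c"])
      (simp_all add: scaleC_add_right comm norm_scaleC mult.commute)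
  then have "bounded_linear (\<lambda>x. scaleC c (blinfun_apply A x))"
    by (rule bounded_linear_compose) (rule blinfun.bounded_linear_right)
  then show ?thesis
    by (simp add: scale_op_def bounded_linear_Blinfun_apply)
qed

definition positive_op :: "('a::complex_hilbert_space) oper \<Rightarrow> bool" where
  "positive_op A \<longleftrightarrow> A \<in> bounded_ops \<and> (\<forall>x. cinner (blinfun_apply A x) x \<in> \<real>\<^sub>\<ge>\<^sub>0)"

definition projection :: "('a::complex_hilbert_space) oper \<Rightarrow> bool" where
  "projection p \<longleftrightarrow> p \<in> bounded_ops \<and> p o\<^sub>L p = p \<and>
     (\<forall>x y. cinner (blinfun_apply p x) y = cinner x (blinfun_apply p y))"

text \<open>The trace \<open>\<Sum>e. \<langle>A e, e\<rangle>\<close> along an orthonormal basis, with values in \<open>[0,\<infinity>]\<close>. It is only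
  meaningful for positive operators, where it does not depend on the basis.\<close>

definition trace_op :: "('a::complex_hilbert_space) oper \<Rightarrow> ennreal" where
  "trace_op A =
     (\<Sum>\<^sub>\<infinity>e\<in>(SOME B. orthonormal_basis B). ennreal (Re (cinner (blinfun_apply A e) e)))"

definition \<mu> :: "real \<Rightarrow> ('a::complex_hilbert_space) oper \<Rightarrow> real" where
  "\<mu> t A = Inf {norm (A o\<^sub>L p) | p. projection p \<and> trace_op (id_blinfun - p) \<le> ennreal t}"

section \<open>Symmetric operator ideals\<close>

definition two_sided_ideal :: "('a::complex_hilbert_space) oper set \<Rightarrow> bool" where
  "two_sided_ideal \<E> \<longleftrightarrow> \<E> \<subseteq> bounded_ops \<and> 0 \<in> \<E> \<and>
     (\<forall>A\<in>\<E>. \<forall>B\<in>\<E>. A + B \<in> \<E>) \<and>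
     (\<forall>A\<in>\<E>. \<forall>c. scale_op c A \<in> \<E>) \<and>
     (\<forall>A\<in>\<E>. \<forall>B\<in>bounded_ops. A o\<^sub>L B \<in> \<E> \<and> B o\<^sub>L A \<in> \<E>)"

definition norm_on :: "('a::complex_hilbert_space) oper set \<Rightarrow> ('a oper \<Rightarrow> real) \<Rightarrow> bool" where
  "norm_on \<E> N \<longleftrightarrow>
     (\<forall>A\<in>\<E>. 0 \<le> N A \<and> (N A = 0 \<longleftrightarrow> A = 0)) \<and>
     (\<forall>A\<in>\<E>. \<forall>B\<in>\<E>. N (A + B) \<le> N A + N B) \<and>
     (\<forall>A\<in>\<E>. \<forall>c. N (scale_op c A) = cmod c * N A)"

definition complete_norm_on :: "('a::complex_hilbert_space) oper set \<Rightarrow> ('a oper \<Rightarrow> real) \<Rightarrow> bool" where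
  "complete_norm_on \<E> N \<longleftrightarrow> norm_on \<E> N \<and>
     (\<forall>X :: nat \<Rightarrow> 'a oper.
        (\<forall>n. X n \<in> \<E>) \<and> (\<forall>e>0. \<exists>M. \<forall>m\<ge>M. \<forall>n\<ge>M. N (X m - X n) < e) \<longrightarrow>
        (\<exists>L\<in>\<E>. (\<lambda>n. N (X n - L)) \<longlonglongrightarrow> 0))"

definition symmetric_operator_ideal ::
    "('a::complex_hilbert_space) oper set \<Rightarrow> ('a oper \<Rightarrow> real) \<Rightarrow> bool" where
  "symmetric_operator_ideal \<E> N \<longleftrightarrow> two_sided_ideal \<E> \<and> complete_norm_on \<E> N \<and>
     (\<forall>A\<in>\<E>. \<forall>B\<in>bounded_ops. N (A o\<^sub>L B) \<le> N A * norm B \<and> N (B o\<^sub>L A) \<le> N A * norm B)"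

definition positive_cone :: "('a::complex_hilbert_space) oper set \<Rightarrow> 'a oper set" where
  "positive_cone \<E> = {A \<in> \<E>. positive_op A}"

text \<open>Only the values of \<open>\<psi>\<close> on \<open>[0,\<infinity>)\<close> matter.\<close>

definition marcinkiewicz_fun :: "(real \<Rightarrow> real) \<Rightarrow> bool" where
  "marcinkiewicz_fun \<psi> \<longleftrightarrow> concave_on {0..} \<psi> \<and> mono_on {0..} \<psi> \<and>
     (\<forall>t\<ge>0. 0 \<le> \<psi> t) \<and> (\<forall>t>0. 0 < \<psi> t)"

definition mean_seq :: "(real \<Rightarrow> real) \<Rightarrow> ('a::complex_hilbert_space) oper \<Rightarrow> nat \<Rightarrow> real" where
  "mean_seq \<psi> A n = 1 / \<psi> (real n + 1) * (\<Sum>k=0..n. \<mu> (real k) A)"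

definition marcinkiewicz_ideal :: "(real \<Rightarrow> real) \<Rightarrow> ('a::complex_hilbert_space) oper set" where
  "marcinkiewicz_ideal \<psi> = {A \<in> bounded_ops. bdd_above (range (mean_seq \<psi> A))}"

section \<open>States on bounded sequences\<close>

text \<open>Functionals on \<open>l_infty\<close> are total functions on sequences; their values at unbounded
  sequences are never used.\<close>

definition l_infty :: "(nat \<Rightarrow> complex) set" where
  "l_infty = {a. bounded (range a)}"

definition state :: "((nat \<Rightarrow> complex) \<Rightarrow> complex) \<Rightarrow> bool" where
  "state \<omega> \<longleftrightarrow>
     (\<forall>a\<in>l_infty. \<forall>b\<in>l_infty. \<omega> (\<lambda>n. a n + b n) = \<omega> a + \<omega> b) \<and>
     (\<forall>a\<in>l_infty. \<forall>c. \<omega> (\<lambda>n. c * a n) = c * \<omega> a) \<and>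
     (\<forall>a\<in>l_infty. (\<forall>n. a n \<in> \<real>\<^sub>\<ge>\<^sub>0) \<longrightarrow> \<omega> a \<in> \<real>\<^sub>\<ge>\<^sub>0) \<and>
     \<omega> (\<lambda>_. 1) = 1"

definition singular_state :: "((nat \<Rightarrow> complex) \<Rightarrow> complex) \<Rightarrow> bool" where
  "singular_state \<omega> \<longleftrightarrow> state \<omega> \<and> (\<forall>a. finite {n. a n \<noteq> 0} \<longrightarrow> \<omega> a = 0)"

definition dilation :: "nat \<Rightarrow> (nat \<Rightarrow> 'b) \<Rightarrow> nat \<Rightarrow> 'b" where
  "dilation n a = (\<lambda>k. a (k div n))"

definition dilation_invariant :: "((nat \<Rightarrow> complex) \<Rightarrow> complex) \<Rightarrow> bool" where
  "dilation_invariant \<omega> \<longleftrightarrow> (\<forall>n\<ge>1. \<forall>a\<in>l_infty. \<omega> (dilation n a) = \<omega> a)"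

text \<open>The extension of a state to all nonnegative sequences. The state is real and nonnegative on the
  sequences \<open>y\<close> below, so that taking the real part loses nothing.\<close>

definition extended_state :: "((nat \<Rightarrow> complex) \<Rightarrow> complex) \<Rightarrow> (nat \<Rightarrow> real) \<Rightarrow> ennreal" where
  "extended_state \<omega> x =
     (SUP y \<in> {y :: nat \<Rightarrow> real. bounded (range y) \<and> (\<forall>n. 0 \<le> y n \<and> y n \<le> x n)}.
        ennreal (Re (\<omega> (\<lambda>n. complex_of_real (y n)))))"

definition \<tau> ::
    "((nat \<Rightarrow> complex) \<Rightarrow> complex) \<Rightarrow> (real \<Rightarrow> real) \<Rightarrow> ('a::complex_hilbert_space) oper \<Rightarrow> ennreal" where
  "\<tau> \<omega> \<psi> A = extended_state \<omega> (mean_seq \<psi> A)"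

end

theory Submission
  imports Defs
begin

text \<open>For positive \<open>A\<close>, the sum of the first \<open>n\<close> singular values is the supremum of
  \<open>\<Sum>i<n. \<langle>A e\<^sub>i, e\<^sub>i\<rangle>\<close> over orthonormal systems. Writing \<open>S\<^sub>n\<close> for this sum, one reads off
  \<open>S\<^sub>n(A + B) \<le> S\<^sub>n(A) + S\<^sub>n(B) \<le> S\<^sub>2\<^sub>n(A + B)\<close>. Hence \<open>\<tau>\<close> is subadditive, and its superadditivity is
  governed by \<open>x\<^sub>2\<^sub>n\<^sub>+\<^sub>1 \<psi>(2n + 2) / \<psi>(n + 1)\<close>, where \<open>x\<close> is the sequence of means of \<open>A + B\<close>. Dilation
  invariance gives \<open>\<omega>(x\<^sub>2\<^sub>n\<^sub>+\<^sub>1) = \<omega>(x)\<close>, and the factor \<open>\<psi>(2n + 2) / \<psi>(n + 1)\<close> is harmless as soon as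
  \<open>\<omega>\<close> maps it to \<open>1\<close>, even for unbounded \<open>x\<close>, because \<open>\<omega>(x) < \<infinity>\<close>. Conversely, two orthogonal
  diagonal operators with singular values \<open>\<psi>(k + 1) - \<psi>(k)\<close> have means constantly \<open>1\<close>, while their sum
  has \<open>x\<^sub>2\<^sub>n\<^sub>+\<^sub>1 = 2\<psi>(n + 1) / \<psi>(2n + 2)\<close>; additivity forces \<open>\<omega>\<close> of this to be \<open>2\<close>.\<close>

section \<open>Orthonormal sets\<close>

text \<open>Three obstacles shape the proof. First, \<open>\<E>\<close> may contain non-compact
  operators (for \<open>\<psi> t = t\<close> it is all of \<open>bounded_ops\<close>), so a
  maximising orthonormal system need not exist; Ky Fan's principle is therefore proved with
  approximate eigenvectors and an arbitrarily small error. Second, dilating the odd-indexed means by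
  2 does not give back \<open>x\<close>: at an even index \<open>k\<close> it shows the value at
  \<open>k + 1\<close>. Neighbouring means differ at most by the factor
  \<open>1 + 1 / (k + 1)\<close>, and a singular state does not see the excess. The same rounding
  replaces \<open>\<psi> (2 * n + 1)\<close> in the statement by \<open>\<psi> (2 * n + 2)\<close>,
  which fits sums of \<open>n + 1\<close> and \<open>2 * (n + 1)\<close> singular values. Third, in
  the converse \<open>\<omega>\<close> is known at \<open>2 / (1 + u)\<close>, where
  \<open>u\<close> is the excess of the growth ratio over 1, but wanted at \<open>u\<close>. On
  \<open>[0, 1]\<close> one has \<open>u + 2 / (1 + u) \<le> 2\<close>, and positivity of
  \<open>\<omega>\<close> does the rest.\<close>

interpretation cvs: vector_space "scaleC :: complex \<Rightarrow> 'a \<Rightarrow> 'a::complex_hilbert_space"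
  by (rule vector_space_scaleC)

lemma cinner_add_right: "cinner x (y + z) = cinner x y + cinner x z"
  by (metis cinner_add_left cinner_commute complex_cnj_add)

lemma cinner_scaleC_right: "cinner x (scaleC c y) = cnj c * cinner x y"
  by (metis cinner_commute cinner_scaleC_left complex_cnj_mult)

lemma cinner_zero_left [simp]: "cinner 0 x = 0"
  using cinner_add_left[of 0 0 x] by simp

lemma cinner_zero_right [simp]: "cinner x 0 = 0"
  using cinner_add_right[of x 0 0] by simp

lemma cinner_minus_left: "cinner (- x) y = - cinner x y"
  using cinner_add_left[of x "- x" y] by (simp add: eq_neg_iff_add_eq_0 add.commute)

lemma cinner_minus_right: "cinner x (- y) = - cinner x y"
  using cinner_add_right[of x y "- y"] by (simp add: eq_neg_iff_add_eq_0 add.commute)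

lemma cinner_diff_left: "cinner (x - y) z = cinner x z - cinner y z"
  using cinner_add_left[of x "- y" z] by (simp add: cinner_minus_left)

lemma cinner_diff_right: "cinner x (y - z) = cinner x y - cinner x z"
  using cinner_add_right[of x y "- z"] by (simp add: cinner_minus_right)

lemma cinner_sum_left: "cinner (\<Sum>i\<in>I. f i) y = (\<Sum>i\<in>I. cinner (f i) y)"
  by (induction I rule: infinite_finite_induct) (simp_all add: cinner_add_left)

lemma cinner_sum_right: "cinner x (\<Sum>i\<in>I. f i) = (\<Sum>i\<in>I. cinner x (f i))"
  by (induction I rule: infinite_finite_induct) (simp_all add: cinner_add_right)

lemma cinner_eq_0_commute: "cinner x y = 0 \<longleftrightarrow> cinner y x = 0"
  by (metis cinner_commute complex_cnj_zero)

lemma cmod_cinner_commute: "cmod (cinner x y) = cmod (cinner y x)"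
  by (metis cinner_commute complex_mod_cnj)

text \<open>A bound on the real parts gives a bound on the modulus: rotate the phase of \<open>y\<close>.\<close>

lemma cmod_cinner_le:
  assumes "\<And>c. \<bar>inner u (scaleC c y)\<bar> \<le> K * norm (scaleC c y)"
  shows "cmod (cinner u y) \<le> K * norm y"
proof (cases "cinner u y = 0")
  case True
  then show ?thesis using assms[of 1] by (simp add: Re_cinner[symmetric])
next
  case False
  define c where "c = cinner u y / complex_of_real (cmod (cinner u y))"
  have c: "cmod c = 1" using False by (simp add: c_def norm_divide)
  have "cinner u (scaleC c y) = cinner u y * cnj (cinner u y) / complex_of_real (cmod (cinner u y))"
    by (simp add: c_def cinner_scaleC_right)
  also have "\<dots> = complex_of_real (cmod (cinner u y))"
    using False by (simp add: complex_norm_square[symmetric] power2_eq_square)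
  finally have "cinner u (scaleC c y) = complex_of_real (cmod (cinner u y))" .
  then have "inner u (scaleC c y) = cmod (cinner u y)"
    by (metis Re_cinner Re_complex_of_real)
  then show ?thesis using assms[of c] by (simp add: norm_scaleC c)
qed

definition orthonormal :: "'a::complex_hilbert_space set \<Rightarrow> bool" where
  "orthonormal E \<longleftrightarrow> (\<forall>e\<in>E. \<forall>f\<in>E. cinner e f = (if e = f then 1 else 0))"

definition proj_span :: "'a::complex_hilbert_space set \<Rightarrow> 'a \<Rightarrow> 'a" where
  "proj_span E x = (\<Sum>e\<in>E. scaleC (cinner x e) e)"

lemma orthonormal_subset: "orthonormal E \<Longrightarrow> F \<subseteq> E \<Longrightarrow> orthonormal F"
  unfolding orthonormal_def by blast

lemma orthonormal_norm: "orthonormal E \<Longrightarrow> e \<in> E \<Longrightarrow> norm e = 1"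
  unfolding orthonormal_def using cinner_self[of e]
  by (metis norm_ge_zero of_real_eq_1_iff power2_eq_1_iff power_one real_sqrt_abs real_sqrt_one abs_of_nonneg)

lemma orthonormal_insert:
  assumes "orthonormal E" "norm x = 1" "\<And>e. e \<in> E \<Longrightarrow> cinner x e = 0"
  shows "orthonormal (insert x E)"
  using assms cinner_self[of x] cinner_eq_0_commute[of x] unfolding orthonormal_def
  by (smt (verit) insert_iff of_real_1 power_one)

lemma cinner_linear_combination:
  assumes "orthonormal E" "finite E" "e \<in> E"
  shows "cinner (\<Sum>f\<in>E. scaleC (u f) f) e = u e"
proof -
  have "cinner (\<Sum>f\<in>E. scaleC (u f) f) e = (\<Sum>f\<in>E. if f = e then u e else 0)"
    unfolding cinner_sum_left
    by (rule sum.cong) (use assms in \<open>auto simp: cinner_scaleC_left orthonormal_def\<close>)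
  then show ?thesis using assms by simp
qed

lemma norm_linear_combination:
  assumes "orthonormal E" "finite E"
  shows "(norm (\<Sum>f\<in>E. scaleC (u f) f))\<^sup>2 = (\<Sum>f\<in>E. (cmod (u f))\<^sup>2)"
proof -
  have "complex_of_real ((norm (\<Sum>f\<in>E. scaleC (u f) f))\<^sup>2) = (\<Sum>f\<in>E. cnj (u f) * u f)"
    unfolding cinner_self[symmetric]
    by (subst cinner_sum_right) (simp add: cinner_scaleC_right cinner_linear_combination[OF assms])
  also have "\<dots> = complex_of_real (\<Sum>f\<in>E. (cmod (u f))\<^sup>2)"
    by (simp add: complex_norm_square mult.commute del: of_real_power)
  finally show ?thesis using of_real_eq_iff by blast
qed

lemma cinner_proj_span:
  "orthonormal E \<Longrightarrow> finite E \<Longrightarrow> e \<in> E \<Longrightarrow> cinner (proj_span E x) e = cinner x e"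
  unfolding proj_span_def by (rule cinner_linear_combination)

lemma norm_diff_proj_span:
  assumes "orthonormal E" "finite E"
  shows "(norm (x - proj_span E x))\<^sup>2 = (norm x)\<^sup>2 - (\<Sum>e\<in>E. (cmod (cinner x e))\<^sup>2)"
proof -
  have 1: "(norm (proj_span E x))\<^sup>2 = (\<Sum>e\<in>E. (cmod (cinner x e))\<^sup>2)"
    unfolding proj_span_def by (rule norm_linear_combination[OF assms])
  have "cinner x (proj_span E x) = (\<Sum>e\<in>E. cnj (cinner x e) * cinner x e)"
    by (simp add: proj_span_def cinner_sum_right cinner_scaleC_right)
  also have "\<dots> = complex_of_real (\<Sum>e\<in>E. (cmod (cinner x e))\<^sup>2)"
    by (simp add: complex_norm_square mult.commute del: of_real_power)
  finally have "inner x (proj_span E x) = (\<Sum>e\<in>E. (cmod (cinner x e))\<^sup>2)"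
    by (metis Re_cinner Re_complex_of_real)
  then show ?thesis using 1
    by (simp add: power2_norm_eq_inner inner_diff_left inner_diff_right inner_commute)
qed

lemma bessel:
  assumes "orthonormal E" "finite E"
  shows "(\<Sum>e\<in>E. (cmod (cinner x e))\<^sup>2) \<le> (norm x)\<^sup>2"
  using norm_diff_proj_span[OF assms, of x] by (smt (verit) zero_le_power2)

lemma proj_span_in_span: "proj_span E x \<in> cvs.span E"
  unfolding proj_span_def by (intro cvs.span_sum cvs.span_scale cvs.span_base)

lemma proj_span_eq:
  assumes "orthonormal E" "finite E" "x \<in> cvs.span E"
  shows "proj_span E x = x"
proof -
  obtain u where "x = (\<Sum>e\<in>E. scaleC (u e) e)"
    using assms cvs.span_finite[of E] by auto
  then show ?thesis
    unfolding proj_span_def by (simp add: cinner_linear_combination assms)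
qed

lemma cinner_span_eq_0:
  assumes "x \<in> cvs.span E" "\<And>e. e \<in> E \<Longrightarrow> cinner e y = 0"
  shows "cinner x y = 0"
  using assms(1)
  by (induction rule: cvs.span_induct_alt)
    (simp_all add: cinner_add_left cinner_scaleC_left assms(2))

text \<open>The error \<open>x - proj_span E x\<close> is orthogonal to the span of
  \<open>E\<close>, so Pythagoras applies to its sum with \<open>proj_span E x - s\<close>. The case
  \<open>s = 0\<close> shows later that the error is no longer than \<open>x\<close>.\<close>

lemma best_approximation:
  assumes "orthonormal E" "finite E" "s \<in> cvs.span E"
  shows "norm (x - proj_span E x) \<le> norm (x - s)"
proof -
  define d where "d = proj_span E x - s"
  have "d \<in> cvs.span E"
    unfolding d_def by (intro cvs.span_diff proj_span_in_span assms)
  then have "cinner d (x - proj_span E x) = 0"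
    by (rule cinner_span_eq_0)
      (metis cinner_diff_left cinner_eq_0_commute cinner_proj_span[OF assms(1,2)] diff_self)
  then have "inner d (x - proj_span E x) = 0"
    by (metis Re_cinner zero_complex.simps(1))
  then have "(norm (x - s))\<^sup>2 = (norm (x - proj_span E x))\<^sup>2 + (norm d)\<^sup>2"
    unfolding d_def
    by (simp add: power2_norm_eq_inner inner_diff_left inner_diff_right inner_commute algebra_simps)
  then show ?thesis
    by (smt (verit) norm_ge_zero power2_le_imp_le zero_le_power2)
qed

section \<open>Dimension counts and Gram-Schmidt\<close>

lemma orthonormal_independent:
  assumes "orthonormal E" "finite E"
  shows "\<not> cvs.dependent E"
  unfolding cvs.dependent_finite[OF assms(2)]
  using cinner_linear_combination[OF assms] by (metis cinner_zero_left)

lemma orthonormal_card_le: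
  assumes "orthonormal E" "finite E" "finite G" "E \<subseteq> cvs.span G"
  shows "card E \<le> card G"
  using cvs.independent_span_bound[OF assms(3) orthonormal_independent[OF assms(1,2)] assms(4)] by simp

lemma gram_schmidt_step:
  assumes "orthonormal E" "finite E"
  obtains F where "orthonormal F" "finite F" "E \<subseteq> F" "x \<in> cvs.span F" "F \<subseteq> cvs.span (insert x E)"
    "card F \<le> Suc (card E)"
proof (cases "x \<in> cvs.span E")
  case True
  show ?thesis
    by (rule that[OF assms]) (use True in \<open>auto intro: cvs.span_base\<close>)
next
  case False
  define z where "z = x - proj_span E x"
  have z0: "z \<noteq> 0" using False proj_span_in_span[of E x] by (auto simp: z_def)
  define f where "f = scaleC (complex_of_real (inverse (norm z))) z"
  have "norm f = 1" using z0 by (simp add: f_def norm_scaleC norm_inverse)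
  moreover have "cinner f e = 0" if "e \<in> E" for e
    by (simp add: f_def cinner_scaleC_left z_def cinner_diff_left cinner_proj_span assms that)
  ultimately have on: "orthonormal (insert f E)" using assms by (intro orthonormal_insert)
  have pr: "proj_span E x \<in> cvs.span (insert y E)" for y
    using proj_span_in_span cvs.span_mono[of E "insert y E"] by blast
  have "scaleC (complex_of_real (norm z)) f = z"
    using z0 by (simp add: f_def)
  then have x: "x = scaleC (complex_of_real (norm z)) f + proj_span E x"
    by (simp add: z_def)
  have xs: "x \<in> cvs.span (insert f E)"
    by (subst x) (intro cvs.span_add cvs.span_scale cvs.span_base pr, simp)
  have "f \<in> cvs.span (insert x E)"
    unfolding f_def z_def by (intro cvs.span_diff cvs.span_scale pr cvs.span_base) simp
  then have "insert f E \<subseteq> cvs.span (insert x E)"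
    by (auto intro: cvs.span_base)
  then show ?thesis using on xs that[of "insert f E"] assms
    by (simp add: card_insert_le_m1 subset_insertI card_insert_if)
qed

text \<open>\<open>E\<close> is kept and only extended, so that sums of non-negative terms over
  \<open>E\<close> can be enlarged to sums over \<open>F\<close>. The inclusions identify the two
  spans, and the bound on \<open>card F\<close> becomes the \<open>2 * n\<close> in
  \<open>sum_mu_superadditive\<close>.\<close>

lemma gram_schmidt:
  assumes "finite X" "orthonormal E" "finite E"
  shows "\<exists>F. orthonormal F \<and> finite F \<and> E \<subseteq> F \<and> X \<subseteq> cvs.span F \<and> F \<subseteq> cvs.span (X \<union> E) \<and>
    card F \<le> card X + card E"
  using assms(1)
proof (induction X)
  case empty
  then show ?case using assms cvs.span_superset by auto
next
  case (insert x X)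
  then obtain F where F: "orthonormal F" "finite F" "E \<subseteq> F" "X \<subseteq> cvs.span F" "F \<subseteq> cvs.span (X \<union> E)"
    "card F \<le> card X + card E" by blast
  obtain G where G: "orthonormal G" "finite G" "F \<subseteq> G" "x \<in> cvs.span G" "G \<subseteq> cvs.span (insert x F)"
    "card G \<le> Suc (card F)" using gram_schmidt_step[OF F(1,2)] by metis
  have "cvs.span F \<subseteq> cvs.span G" by (rule cvs.span_mono[OF G(3)])
  moreover have "insert x F \<subseteq> cvs.span (insert x X \<union> E)"
    using F(5) cvs.span_mono[of "X \<union> E" "insert x X \<union> E"] cvs.span_base[of x "insert x X \<union> E"] by auto
  then have "cvs.span (insert x F) \<subseteq> cvs.span (insert x X \<union> E)"
    by (metis cvs.span_minimal cvs.subspace_span)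
  ultimately show ?case using F G insert by (intro exI[of _ G]) auto
qed

text \<open>Both sides are the trace of the compression of \<open>A\<close> to the common span:
  expand \<open>e\<close> in \<open>F\<close>, exchange the sums and recognise the expansion of
  \<open>f\<close> in \<open>E\<close>.\<close>

lemma sum_cinner_basis_change:
  fixes A :: "'a::complex_hilbert_space oper"
  assumes "orthonormal E" "finite E" "orthonormal F" "finite F"
    "E \<subseteq> cvs.span F" "F \<subseteq> cvs.span E" "A \<in> bounded_ops"
  shows "(\<Sum>e\<in>E. cinner (A e) e) = (\<Sum>f\<in>F. cinner (A f) f)"
proof -
  have "(\<Sum>e\<in>E. cinner (A e) e) = (\<Sum>e\<in>E. cinner (A e) (proj_span F e))"
    by (rule sum.cong) (use assms in \<open>auto simp: proj_span_eq\<close>)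
  also have "\<dots> = (\<Sum>e\<in>E. \<Sum>f\<in>F. cinner f e * cinner (A e) f)"
    by (simp add: proj_span_def cinner_sum_right cinner_scaleC_right cinner_commute[symmetric])
  also have "\<dots> = (\<Sum>f\<in>F. \<Sum>e\<in>E. cinner f e * cinner (A e) f)"
    by (rule sum.swap)
  also have "\<dots> = (\<Sum>f\<in>F. cinner (A (proj_span E f)) f)"
    using assms(7)
    by (simp add: proj_span_def blinfun.sum_right cinner_sum_left bounded_ops_def cinner_scaleC_left)
  also have "\<dots> = (\<Sum>f\<in>F. cinner (A f) f)"
    by (rule sum.cong) (use assms in \<open>auto simp: proj_span_eq\<close>)
  finally show ?thesis .
qed

section \<open>Orthonormal sequences and bases\<close>

lemma exists_unit_orthogonal:
  fixes E :: "'a::complex_hilbert_space set"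
  assumes "infinite_dimensional TYPE('a)" "orthonormal E" "finite E"
  shows "\<exists>x. norm x = 1 \<and> (\<forall>e\<in>E. cinner x e = 0)"
proof -
  obtain y where y: "y \<notin> cvs.span E"
    using assms unfolding infinite_dimensional_def by auto
  define z where "z = y - proj_span E y"
  have z0: "z \<noteq> 0" using y proj_span_in_span[of E y] by (auto simp: z_def)
  have "norm (scaleC (complex_of_real (inverse (norm z))) z) = 1" using z0 by (simp add: norm_scaleC norm_inverse)
  moreover have "cinner (scaleC (complex_of_real (inverse (norm z))) z) e = 0" if "e \<in> E" for e
    by (simp add: cinner_scaleC_left z_def cinner_diff_left cinner_proj_span assms that)
  ultimately show ?thesis by blast
qed

lemma exists_orthonormal_sequence:
  assumes "infinite_dimensional TYPE('a::complex_hilbert_space)"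
  shows "\<exists>c :: nat \<Rightarrow> 'a. inj c \<and> orthonormal (range c)"
proof -
  have "\<exists>c :: nat \<Rightarrow> 'a. \<forall>n. norm (c n) = 1 \<and> (\<forall>m<n. cinner (c n) (c m) = 0)"
  proof (rule dependent_wellorder_choice)
    fix n and c :: "nat \<Rightarrow> 'a"
    assume c: "\<And>m. m < n \<Longrightarrow> norm (c m) = 1 \<and> (\<forall>k<m. cinner (c m) (c k) = 0)"
    have "orthonormal (c ` {..<n})"
      unfolding orthonormal_def using c cinner_self cinner_eq_0_commute
      by (smt (verit) image_iff lessThan_iff linorder_neqE_nat of_real_1 power_one)
    from exists_unit_orthogonal[OF assms this]
    show "\<exists>x. norm x = 1 \<and> (\<forall>m<n. cinner x (c m) = 0)" by auto
  qed auto
  then obtain c :: "nat \<Rightarrow> 'a" where c: "\<And>n. norm (c n) = 1" "\<And>n m. m < n \<Longrightarrow> cinner (c n) (c m) = 0"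
    by blast
  have *: "cinner (c n) (c m) = (if n = m then 1 else 0)" for n m
    using c cinner_self[of "c n"] cinner_eq_0_commute[of "c n" "c m"]
    by (cases n m rule: linorder_cases) auto
  then have "inj c" by (metis injI zero_neq_one)
  moreover have "orthonormal (range c)" unfolding orthonormal_def using * by (auto simp: inj_eq[OF \<open>inj c\<close>])
  ultimately show ?thesis by blast
qed

text \<open>Ensures that the \<open>SOME\<close> in \<open>trace_op\<close> picks a basis; this is
  where separability enters. Gram-Schmidt runs along an enumeration of a countable dense set, whose
  values may repeat or be dependent, so a step may add nothing.\<close>

lemma exists_orthonormal_basis:
  assumes "separable TYPE('a::complex_hilbert_space)"
  shows "\<exists>B :: 'a set. orthonormal_basis B"
proof -
  obtain D :: "'a set" where D: "countable D" "closure D = UNIV"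
    using assms unfolding separable_def by blast
  then have "D \<noteq> {}" by auto
  define d where "d = from_nat_into D"
  have "\<exists>F. \<forall>n. (orthonormal (F n) \<and> finite (F n)) \<and> (F n \<subseteq> F (Suc n) \<and> d n \<in> cvs.span (F (Suc n)))"
  proof (rule dependent_nat_choice)
    show "\<exists>F :: 'a set. orthonormal F \<and> finite F"
      by (rule exI[of _ "{}"]) (simp add: orthonormal_def)
  qed (metis gram_schmidt_step)
  then obtain F where F: "\<And>n. orthonormal (F n)" "\<And>n. F n \<subseteq> F (Suc n)" "\<And>n. d n \<in> cvs.span (F (Suc n))"
    by blast
  have mono: "F m \<subseteq> F n" if "m \<le> n" for m n
    using lift_Suc_mono_le[of F, OF F(2) that] .
  define B where "B = (\<Union>n. F n)"
  have "cinner e f = (if e = f then 1 else 0)" if ef: "e \<in> B" "f \<in> B" for e f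
  proof -
    obtain m n where "e \<in> F m" "f \<in> F n" using ef by (auto simp: B_def)
    then have "e \<in> F (max m n)" "f \<in> F (max m n)"
      using mono[of m "max m n"] mono[of n "max m n"] by auto
    then show ?thesis using F(1) unfolding orthonormal_def by blast
  qed
  moreover have "D \<subseteq> cvs.span B"
  proof
    fix x assume "x \<in> D"
    then obtain n where "x = d n" unfolding d_def using from_nat_into_surj[OF D(1)] by metis
    moreover have "cvs.span (F (Suc n)) \<subseteq> cvs.span B"
      by (rule cvs.span_mono) (auto simp: B_def)
    ultimately show "x \<in> cvs.span B" using F(3) by auto
  qed
  then have "closure (cvs.span B) = UNIV"
    using closure_mono[of D "cvs.span B"] D(2) by auto
  ultimately show ?thesis unfolding orthonormal_basis_def by blast
qed

text \<open>A finite form of Parseval's identity: a vector of the span close to \<open>g\<close>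
  involves finitely many basis vectors, and projecting onto these does at least as well. One
  \<open>F\<close> serves all of \<open>G\<close>, because adding vectors only increases the
  sums.\<close>

lemma parseval_approx:
  fixes B :: "'a::complex_hilbert_space set"
  assumes "orthonormal_basis B" "finite G" "\<epsilon> > 0"
  shows "\<exists>F. finite F \<and> F \<subseteq> B \<and> (\<forall>g\<in>G. (norm g)\<^sup>2 \<le> (\<Sum>b\<in>F. (cmod (cinner g b))\<^sup>2) + \<epsilon>)"
proof -
  have onB: "orthonormal B" using assms(1) unfolding orthonormal_basis_def orthonormal_def by blast
  have "\<exists>F. finite F \<and> F \<subseteq> B \<and> (norm g)\<^sup>2 \<le> (\<Sum>b\<in>F. (cmod (cinner g b))\<^sup>2) + \<epsilon>" for g
  proof -
    have "g \<in> closure (cvs.span B)" using assms(1) unfolding orthonormal_basis_def by auto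
    then obtain s where s: "s \<in> cvs.span B" "dist s g < sqrt \<epsilon>"
      unfolding closure_approachable using assms(3) by (meson real_sqrt_gt_0_iff)
    obtain F where F: "finite F" "F \<subseteq> B" "s \<in> cvs.span F"
      using s(1) cvs.span_explicit[of B] cvs.span_explicit by fastforce
    have on: "orthonormal F" using onB F(2) by (rule orthonormal_subset)
    have "norm (g - proj_span F g) \<le> norm (g - s)" by (rule best_approximation[OF on F(1,3)])
    also have "\<dots> < sqrt \<epsilon>" using s(2) by (simp add: dist_norm norm_minus_commute)
    finally have "(norm (g - proj_span F g))\<^sup>2 < \<epsilon>"
      using assms(3) by (metis norm_ge_zero real_less_rsqrt real_sqrt_abs real_sqrt_less_iff abs_of_nonneg)
    then show ?thesis using norm_diff_proj_span[OF on F(1), of g] F by force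
  qed
  then obtain F where F: "\<And>g. finite (F g)" "\<And>g. F g \<subseteq> B"
    "\<And>g. (norm g)\<^sup>2 \<le> (\<Sum>b\<in>F g. (cmod (cinner g b))\<^sup>2) + \<epsilon>" by metis
  have "(norm g)\<^sup>2 \<le> (\<Sum>b\<in>\<Union>(F ` G). (cmod (cinner g b))\<^sup>2) + \<epsilon>" if "g \<in> G" for g
    using F(3)[of g] sum_mono2[of "\<Union>(F ` G)" "F g" "\<lambda>b. (cmod (cinner g b))\<^sup>2"] F(1) that assms(2)
    by fastforce
  then show ?thesis using F assms(2) by (intro exI[of _ "\<Union>(F ` G)"]) auto
qed

section \<open>Projections, traces and singular values\<close>

lemma scaleR_scaleC: "scaleR r x = scaleC (complex_of_real r) x"
  by (simp add: scaleC_of_real)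

lemma proj_span_add: "proj_span E (x + y) = proj_span E x + proj_span E y"
  by (simp add: proj_span_def cinner_add_left scaleC_add_left sum.distrib)

lemma proj_span_scaleC: "proj_span E (scaleC c x) = scaleC c (proj_span E x)"
  by (simp add: proj_span_def cinner_scaleC_left cvs.scale_sum_right scaleC_scaleC)

definition compl_proj :: "'a::complex_hilbert_space set \<Rightarrow> 'a oper" where
  "compl_proj E = Blinfun (\<lambda>x. x - proj_span E x)"

lemma norm_diff_proj_span_le:
  assumes "orthonormal E" "finite E"
  shows "norm (x - proj_span E x) \<le> norm x"
  using best_approximation[OF assms cvs.span_zero, of x] by simp

lemma compl_proj_apply:
  assumes "orthonormal E" "finite E"
  shows "compl_proj E x = x - proj_span E x"
proof -
  have "bounded_linear (\<lambda>x. x - proj_span E x)"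
    by (rule bounded_linear_intro[of _ 1])
      (simp_all add: proj_span_add norm_diff_proj_span_le[OF assms] scaleR_scaleC proj_span_scaleC
        cvs.scale_right_diff_distrib)
  then show ?thesis by (simp add: compl_proj_def bounded_linear_Blinfun_apply)
qed

lemma cinner_compl_proj:
  "orthonormal E \<Longrightarrow> finite E \<Longrightarrow> e \<in> E \<Longrightarrow> cinner (compl_proj E x) e = 0"
  by (simp add: compl_proj_apply cinner_diff_left cinner_proj_span)

lemma projection_compl_proj:
  assumes "orthonormal E" "finite E"
  shows "projection (compl_proj E)"
  unfolding projection_def
proof (intro conjI allI)
  show "compl_proj E \<in> bounded_ops"
    unfolding bounded_ops_def
    by (simp add: compl_proj_apply[OF assms] proj_span_scaleC cvs.scale_right_diff_distrib)
  have "proj_span E (compl_proj E x) = 0" for x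
    by (simp add: proj_span_def cinner_compl_proj[OF assms])
  then show "compl_proj E o\<^sub>L compl_proj E = compl_proj E"
    by (intro blinfun_eqI) (simp add: compl_proj_apply[OF assms, of "compl_proj E _"])
  show "cinner (compl_proj E x) y = cinner x (compl_proj E y)" for x y
    by (simp add: compl_proj_apply[OF assms] cinner_diff_left cinner_diff_right proj_span_def
        cinner_sum_left cinner_sum_right cinner_scaleC_left cinner_scaleC_right
        cinner_commute[symmetric] mult.commute)
qed

section \<open>Traces of projections as dimensions\<close>

lemma trace_op_le_iff:
  fixes A :: "'a::complex_hilbert_space oper"
  assumes "\<And>x. 0 \<le> Re (cinner (A x) x)" "0 \<le> t"
  shows "trace_op A \<le> ennreal t \<longleftrightarrow>
    (\<forall>F. finite F \<and> F \<subseteq> (SOME B. orthonormal_basis B) \<longrightarrow> (\<Sum>e\<in>F. Re (cinner (A e) e)) \<le> t)"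
    (is "?L \<longleftrightarrow> ?R")
proof
  assume ?L
  show ?R
  proof (intro allI impI)
    fix F assume F: "finite F \<and> F \<subseteq> (SOME B. orthonormal_basis (B :: 'a set))"
    have "ennreal (\<Sum>e\<in>F. Re (cinner (A e) e)) = (\<Sum>e\<in>F. ennreal (Re (cinner (A e) e)))"
      by (rule sum_ennreal[symmetric]) (simp add: assms)
    also have "\<dots> \<le> trace_op A"
      unfolding trace_op_def using F
      by (subst infsum_finite[symmetric], simp, intro infsum_mono_neutral)
        (auto simp: nonneg_summable_on_complete)
    also note \<open>?L\<close>
    finally show "(\<Sum>e\<in>F. Re (cinner (A e) e)) \<le> t" using assms(2) by simp
  qed
next
  assume R: ?R
  show ?L
    unfolding trace_op_def
  proof (rule infsum_le_finite_sums)
    fix F assume F: "finite F" "F \<subseteq> (SOME B. orthonormal_basis (B :: 'a set))"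
    have "(\<Sum>e\<in>F. ennreal (Re (cinner (A e) e))) = ennreal (\<Sum>e\<in>F. Re (cinner (A e) e))"
      by (rule sum_ennreal) (simp add: assms)
    then show "(\<Sum>e\<in>F. ennreal (Re (cinner (A e) e))) \<le> ennreal t"
      using R F by (simp add: ennreal_leI)
  qed (simp add: nonneg_summable_on_complete)
qed

lemma some_orthonormal_basis:
  "separable TYPE('a::complex_hilbert_space) \<Longrightarrow> orthonormal_basis (SOME B :: 'a set. orthonormal_basis B)"
  by (rule someI_ex) (rule exists_orthonormal_basis)

lemma cinner_id_minus_projection:
  assumes "projection p"
  shows "cinner ((id_blinfun - p) x) x = complex_of_real ((norm (x - p x))\<^sup>2)"
proof -
  have "p (p x) = p x" using assms unfolding projection_def by (metis blinfun_apply_blinfun_compose)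
  then have "cinner (x - p x) (p x) = 0"
    using assms unfolding projection_def by (simp add: cinner_diff_left)
  then show ?thesis
    by (simp add: blinfun.diff_left cinner_diff_right cinner_self[symmetric] del: of_real_power)
qed

text \<open>After exchanging the sums, Bessel's inequality for the basis bounds the contribution of
  each \<open>e\<close> by 1.\<close>

lemma trace_compl_proj_le:
  fixes E :: "'a::complex_hilbert_space set"
  assumes "separable TYPE('a)" "orthonormal E" "finite E" "card E \<le> k"
  shows "trace_op (id_blinfun - compl_proj E) \<le> ennreal (real k)"
proof -
  define B :: "'a set" where "B = (SOME B. orthonormal_basis B)"
  have onB: "orthonormal B"
    using some_orthonormal_basis[OF assms(1)] unfolding B_def orthonormal_basis_def orthonormal_def by blast
  note * = cinner_id_minus_projection[OF projection_compl_proj[OF assms(2,3)]]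
  show ?thesis
  proof (subst trace_op_le_iff, simp add: *, simp, fold B_def, intro allI impI)
    fix F assume F: "finite F \<and> F \<subseteq> B"
    have "(\<Sum>b\<in>F. Re (cinner ((id_blinfun - compl_proj E) b) b)) = (\<Sum>b\<in>F. (norm (proj_span E b))\<^sup>2)"
      by (simp add: * compl_proj_apply[OF assms(2,3)])
    also have "\<dots> = (\<Sum>b\<in>F. \<Sum>e\<in>E. (cmod (cinner b e))\<^sup>2)"
      unfolding proj_span_def by (simp add: norm_linear_combination[OF assms(2,3)])
    also have "\<dots> = (\<Sum>e\<in>E. \<Sum>b\<in>F. (cmod (cinner e b))\<^sup>2)"
      by (subst sum.swap) (simp add: cmod_cinner_commute)
    also have "\<dots> \<le> (\<Sum>e\<in>E. (norm e)\<^sup>2)"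
      using F orthonormal_subset[OF onB] by (intro sum_mono bessel) auto
    also have "\<dots> = real (card E)" using orthonormal_norm[OF assms(2)] by simp
    finally show "(\<Sum>b\<in>F. Re (cinner ((id_blinfun - compl_proj E) b) b)) \<le> real k"
      using assms(4) by simp
  qed
qed

text \<open>The kernel of \<open>p\<close> is the range of \<open>id_blinfun - p\<close>, whose
  dimension the trace controls. The slack \<open>\<epsilon>\<close> pays for the finite form of
  Parseval; \<open>\<delta>\<close> is its share for each element of \<open>G\<close>.\<close>

lemma card_le_trace_projection:
  fixes G :: "'a::complex_hilbert_space set"
  assumes "separable TYPE('a)" "projection p" "trace_op (id_blinfun - p) \<le> ennreal t" "0 \<le> t"
    and G: "orthonormal G" "finite G" "\<And>g. g \<in> G \<Longrightarrow> p g = 0"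
  shows "real (card G) \<le> t"
proof (rule field_le_epsilon)
  fix \<epsilon> :: real assume "\<epsilon> > 0"
  define \<delta> where "\<delta> = \<epsilon> / (real (card G) + 1)"
  have "\<delta> > 0" using \<open>\<epsilon> > 0\<close> by (simp add: \<delta>_def add_nonneg_pos)
  have \<delta>: "real (card G) * \<delta> \<le> \<epsilon>" using \<open>\<epsilon> > 0\<close> by (simp add: \<delta>_def field_simps)
  define B :: "'a set" where "B = (SOME B. orthonormal_basis B)"
  note * = cinner_id_minus_projection[OF assms(2)]
  obtain F where F: "finite F" "F \<subseteq> B" "\<And>g. g \<in> G \<Longrightarrow> (norm g)\<^sup>2 \<le> (\<Sum>b\<in>F. (cmod (cinner g b))\<^sup>2) + \<delta>"
    using parseval_approx[OF some_orthonormal_basis[OF assms(1)] G(2) \<open>\<delta> > 0\<close>] unfolding B_def by blast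
  \<comment> \<open>\<open>p\<close> is self-adjoint and kills \<open>g\<close>.\<close>
  have "cinner (x - p x) g = cinner x g" if "g \<in> G" for x g
    using assms(2) G(3)[OF that] unfolding projection_def by (simp add: cinner_diff_left)
  then have ce: "(\<Sum>g\<in>G. (cmod (cinner g b))\<^sup>2) \<le> (norm (b - p b))\<^sup>2" for b
    using bessel[OF G(1,2), of "b - p b"] by (simp add: cmod_cinner_commute[of _ b])
  have "real (card G) = (\<Sum>g\<in>G. (norm g)\<^sup>2)"
    using orthonormal_norm[OF G(1)] by simp
  also have "\<dots> \<le> (\<Sum>g\<in>G. (\<Sum>b\<in>F. (cmod (cinner g b))\<^sup>2) + \<delta>)"
    by (intro sum_mono F)
  also have "\<dots> = (\<Sum>b\<in>F. \<Sum>g\<in>G. (cmod (cinner g b))\<^sup>2) + real (card G) * \<delta>"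
    by (simp add: sum.distrib) (rule sum.swap)
  also have "\<dots> \<le> (\<Sum>b\<in>F. Re (cinner ((id_blinfun - p) b) b)) + real (card G) * \<delta>"
    using ce by (simp add: * sum_mono)
  also have "\<dots> \<le> t + real (card G) * \<delta>"
    using assms(3) F(1,2) trace_op_le_iff[of "id_blinfun - p" t] assms(4) by (simp add: * B_def)
  finally show "real (card G) \<le> t + \<epsilon>" using \<delta> by simp
qed

text \<open>\<open>id_blinfun - p\<close> maps the span of \<open>E\<close> into a space of
  dimension at most \<open>k\<close>, so it kills a non-zero vector of this larger-dimensional
  span.\<close>

lemma projection_fixes_unit:
  fixes E :: "'a::complex_hilbert_space set"
  assumes "separable TYPE('a)" "projection p" "trace_op (id_blinfun - p) \<le> ennreal (real k)"
    and E: "orthonormal E" "finite E" "k < card E"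
  shows "\<exists>x\<in>cvs.span E. norm x = 1 \<and> p x = x"
proof -
  define q where "q x = x - p x" for x
  have bp: "p (scaleC c x) = scaleC c (p x)" for c x
    using assms(2) unfolding projection_def bounded_ops_def by blast
  have q_scale: "q (scaleC c x) = scaleC c (q x)" for c x
    by (simp add: q_def bp cvs.scale_right_diff_distrib)
  have q_add: "q (x + y) = q x + q y" for x y
    by (simp add: q_def blinfun.add_right)
  have q_0: "q 0 = 0" by (simp add: q_def)
  have q_sum: "q (\<Sum>i\<in>I. f i) = (\<Sum>i\<in>I. q (f i))" for I :: "'a set" and f
    by (induction I rule: infinite_finite_induct) (simp_all add: q_add q_0)
  have pq: "p (q x) = 0" for x
    using assms(2) unfolding projection_def q_def by (metis blinfun.diff_right blinfun_apply_blinfun_compose diff_self)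
  have "orthonormal ({} :: 'a set)" by (simp add: orthonormal_def)
  then obtain G where G: "orthonormal G" "finite G" "q ` E \<subseteq> cvs.span G" "G \<subseteq> cvs.span (q ` E)"
    using gram_schmidt[of "q ` E" "{}"] E(2) by auto
  have "p g = 0" if "g \<in> cvs.span (q ` E)" for g
    using that by (induction rule: cvs.span_induct_alt) (auto simp: blinfun.add_right bp pq)
  then have cardG: "card G \<le> k"
    using card_le_trace_projection[OF assms(1-3) _ G(1,2)] G(4) by auto
  have "\<exists>x\<in>cvs.span E. x \<noteq> 0 \<and> q x = 0"
  \<comment> \<open>If two elements of \<open>E\<close> have the same image, the image as a set
    hides this relation and may be independent. Their difference is then the wanted vector.\<close>
  proof (cases "inj_on q E")
    case False
    then obtain e f where ef: "e \<in> E" "f \<in> E" "e \<noteq> f" "q e = q f" unfolding inj_on_def by blast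
    have "q (e - f) = q e - q f" by (simp add: q_def blinfun.diff_right)
    then show ?thesis using ef by (intro bexI[of _ "e - f"] cvs.span_diff cvs.span_base) auto
  next
    case True
    have "cvs.dependent (q ` E)"
      using cvs.independent_span_bound[OF G(2) _ G(3)] card_image[OF True] cardG E(3) by fastforce
    then obtain u where u: "\<exists>v\<in>q ` E. u v \<noteq> 0" "(\<Sum>v\<in>q ` E. scaleC (u v) v) = 0"
      using cvs.dependent_finite[of "q ` E"] E(2) by blast
    define x where "x = (\<Sum>e\<in>E. scaleC (u (q e)) e)"
    obtain e where e: "e \<in> E" "u (q e) \<noteq> 0" using u(1) by blast
    have "cinner x e = u (q e)"
      unfolding x_def by (rule cinner_linear_combination[OF E(1,2) e(1)])
    then have "x \<noteq> 0" using e(2) by auto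
    moreover have "q x = 0"
      using u(2) unfolding x_def by (simp add: q_sum q_scale sum.reindex[OF True])
    moreover have "x \<in> cvs.span E"
      unfolding x_def by (intro cvs.span_sum cvs.span_scale cvs.span_base)
    ultimately show ?thesis by blast
  qed
  then obtain x where x: "x \<in> cvs.span E" "x \<noteq> 0" "p x = x" by (auto simp: q_def)
  define y where "y = scaleC (complex_of_real (inverse (norm x))) x"
  have "norm y = 1" "p y = y" "y \<in> cvs.span E"
    using x by (simp_all add: y_def norm_scaleC norm_inverse bp cvs.span_scale)
  then show ?thesis by blast
qed

section \<open>Upper and lower bounds for singular values\<close>

lemma mu_le:
  fixes A :: "'a::complex_hilbert_space oper"
  assumes "projection p" "trace_op (id_blinfun - p) \<le> ennreal t"
  shows "\<mu> t A \<le> norm (A o\<^sub>L p)"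
  unfolding \<mu>_def by (rule cInf_lower) (use assms in \<open>auto intro: bdd_belowI[of _ 0]\<close>)

lemma mu_set_nonempty:
  fixes A :: "'a::complex_hilbert_space oper"
  shows "{norm (A o\<^sub>L p) | p. projection p \<and> trace_op (id_blinfun - p) \<le> ennreal t} \<noteq> {}"
proof -
  have "projection (id_blinfun :: 'a oper)"
    unfolding projection_def bounded_ops_def by (auto intro: blinfun_eqI)
  moreover have "trace_op (id_blinfun - id_blinfun :: 'a oper) \<le> ennreal t"
    by (simp add: trace_op_def)
  ultimately show ?thesis by blast
qed

lemma mu_less_obtain:
  fixes A :: "'a::complex_hilbert_space oper"
  assumes "\<mu> t A < r"
  obtains p where "projection p" "trace_op (id_blinfun - p) \<le> ennreal t" "norm (A o\<^sub>L p) < r"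
  using cInf_lessD[OF mu_set_nonempty assms[unfolded \<mu>_def]] that by blast

lemma mu_geI:
  fixes A :: "'a::complex_hilbert_space oper"
  assumes "\<And>p. projection p \<Longrightarrow> trace_op (id_blinfun - p) \<le> ennreal t \<Longrightarrow> r \<le> norm (A o\<^sub>L p)"
  shows "r \<le> \<mu> t A"
  unfolding \<mu>_def by (rule cInf_greatest[OF mu_set_nonempty]) (use assms in auto)

lemma mu_nonneg: "0 \<le> \<mu> t A"
  by (rule mu_geI) simp

lemma mu_antimono: "s \<le> t \<Longrightarrow> \<mu> t A \<le> \<mu> s A"
  by (rule mu_geI) (use mu_le ennreal_leI order_trans in blast)

lemma mu_le_compl_proj:
  fixes A :: "'a::complex_hilbert_space oper"
  assumes "separable TYPE('a)" "orthonormal E" "finite E" "card E \<le> k" "0 \<le> c"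
    and "\<And>x. (\<And>e. e \<in> E \<Longrightarrow> cinner x e = 0) \<Longrightarrow> norm (A x) \<le> c * norm x"
  shows "\<mu> (real k) A \<le> c"
proof -
  have "norm (A (compl_proj E x)) \<le> c * norm x" for x
  proof -
    have "norm (A (compl_proj E x)) \<le> c * norm (compl_proj E x)"
      by (rule assms(6)) (rule cinner_compl_proj[OF assms(2,3)])
    also have "\<dots> \<le> c * norm x"
      using norm_diff_proj_span_le[OF assms(2,3)] assms(5)
      by (intro mult_left_mono) (simp_all add: compl_proj_apply[OF assms(2,3)])
    finally show ?thesis .
  qed
  then have "norm (A o\<^sub>L compl_proj E) \<le> c"
    by (intro norm_blinfun_bound assms(5)) simp
  then show ?thesis
    using mu_le[OF projection_compl_proj[OF assms(2,3)] trace_compl_proj_le[OF assms(1-4)], of A] by simp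
qed

lemma mu_ge_span:
  fixes A :: "'a::complex_hilbert_space oper"
  assumes "separable TYPE('a)" "orthonormal E" "finite E" "k < card E"
    and "\<And>x. x \<in> cvs.span E \<Longrightarrow> norm x = 1 \<Longrightarrow> c \<le> norm (A x)"
  shows "c \<le> \<mu> (real k) A"
proof (rule mu_geI)
  fix p :: "'a oper" assume "projection p" "trace_op (id_blinfun - p) \<le> ennreal (real k)"
  from projection_fixes_unit[OF assms(1) this assms(2-4)]
  obtain x where x: "x \<in> cvs.span E" "norm x = 1" "p x = x" by blast
  have "c \<le> norm (A x)" by (rule assms(5)[OF x(1,2)])
  also have "\<dots> \<le> norm (A o\<^sub>L p)"
    using norm_blinfun[of "A o\<^sub>L p" x] x(2,3) by simp
  finally show "c \<le> norm (A o\<^sub>L p)" .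
qed

section \<open>Ky Fan's variational principle\<close>

lemma quadratic_nonneg_discriminant:
  fixes a b c :: real
  assumes "\<And>t. 0 \<le> a + 2 * b * t + c * t\<^sup>2" "0 \<le> c"
  shows "b\<^sup>2 \<le> a * c"
proof (cases "c = 0")
  case True
  have "b = 0"
  proof (rule ccontr)
    assume "b \<noteq> 0"
    \<comment> \<open>With \<open>c = 0\<close> the form is affine in \<open>t\<close>; at this
      \<open>t\<close> its value is -1.\<close>
    then show False using assms(1)[of "- (a + 1) / (2 * b)"] True by simp
  qed
  then show ?thesis using True by simp
next
  case False
  have "0 \<le> a + 2 * b * (- b / c) + c * (- b / c)\<^sup>2" by (rule assms(1))
  also have "\<dots> = a - b\<^sup>2 / c" using False by (simp add: field_simps power2_eq_square)
  finally show ?thesis using False assms(2) by (simp add: field_simps)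
qed

text \<open>Non-negativity is asked only at \<open>y\<close> and on the line through
  \<open>x\<close> in direction \<open>y\<close>, because the form of
  \<open>\<Lambda> *\<^sub>R id_blinfun - A\<close> used later is known to be non-negative only on
  an orthogonal complement.\<close>

lemma symmetric_form_cauchy_schwarz:
  fixes T :: "'a::real_inner \<Rightarrow>\<^sub>L 'a"
  assumes "\<And>u v. inner (T u) v = inner u (T v)"
    and "\<And>t. 0 \<le> inner (T (x + t *\<^sub>R y)) (x + t *\<^sub>R y)" "0 \<le> inner (T y) y"
  shows "(inner (T x) y)\<^sup>2 \<le> inner (T x) x * inner (T y) y"
proof (rule quadratic_nonneg_discriminant[OF _ assms(3)])
  fix t
  have "inner (T y) x = inner (T x) y" by (metis assms(1) inner_commute)
  then show "0 \<le> inner (T x) x + 2 * inner (T x) y * t + inner (T y) y * t\<^sup>2"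
    using assms(2)[of t]
    by (simp add: blinfun.add_right blinfun.scaleR_right inner_add_left inner_add_right power2_eq_square
        algebra_simps)
qed

lemma positive_op_nonneg: "positive_op A \<Longrightarrow> 0 \<le> inner (A x) x"
  unfolding positive_op_def by (metis Re_cinner complex_nonneg_Reals_iff)

text \<open>Positivity of \<open>\<langle>A(x + \<i>y), x + \<i>y\<rangle>\<close> includes that its imaginary part vanishes.\<close>

lemma positive_op_symmetric:
  assumes "positive_op A"
  shows "inner (A x) y = inner x (A y)"
proof -
  have A: "A (scaleC c z) = scaleC c (A z)" for c z
    using assms unfolding positive_op_def bounded_ops_def by blast
  have im: "Im (cinner (A z) z) = 0" for z
    using assms unfolding positive_op_def by (metis complex_nonneg_Reals_iff)
  have "Im (cinner (A (x + scaleC \<i> y)) (x + scaleC \<i> y)) = Re (cinner (A y) x) - Re (cinner (A x) y)"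
    by (simp add: A blinfun.add_right cinner_add_left cinner_add_right cinner_scaleC_left
        cinner_scaleC_right im)
  then show ?thesis using im[of "x + scaleC \<i> y"] by (simp add: Re_cinner inner_commute)
qed

lemma Im_cinner: "Im (cinner x y) = inner x (scaleC \<i> y)"
  by (simp add: Re_cinner[symmetric] cinner_scaleC_right)

lemma positive_op_hermitian:
  assumes "positive_op A"
  shows "cinner (A x) y = cinner x (A y)"
proof (rule complex_eqI)
  have "A (scaleC \<i> y) = scaleC \<i> (A y)"
    using assms unfolding positive_op_def bounded_ops_def by blast
  then show "Im (cinner (A x) y) = Im (cinner x (A y))"
    by (simp add: Im_cinner positive_op_symmetric[OF assms])
qed (simp add: Re_cinner positive_op_symmetric[OF assms])

lemma positive_op_add: "positive_op A \<Longrightarrow> positive_op B \<Longrightarrow> positive_op (A + B)"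
  unfolding positive_op_def bounded_ops_def
  by (auto simp: blinfun.add_left cinner_add_left scaleC_add_right intro: nonneg_Reals_add_I)

section \<open>Partial traces against sums of singular values\<close>

lemma sum_inner_basis_change:
  fixes A :: "'a::complex_hilbert_space oper"
  assumes "orthonormal E" "finite E" "orthonormal F" "finite F"
    "E \<subseteq> cvs.span F" "F \<subseteq> cvs.span E" "A \<in> bounded_ops"
  shows "(\<Sum>e\<in>E. inner (A e) e) = (\<Sum>f\<in>F. inner (A f) f)"
  using arg_cong[OF sum_cinner_basis_change[OF assms], of Re] by (simp add: Re_cinner)

text \<open>If \<open>card E = Suc n\<close>, the span of \<open>E\<close> contains a unit vector
  \<open>x\<close> fixed by a nearly optimal \<open>p\<close> for \<open>\<mu> (real n) A\<close>,
  and there \<open>inner (A x) x\<close> is at most \<open>norm (A o\<^sub>L p)\<close>. Rotating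
  the basis so that it contains \<open>x\<close> leaves the sum unchanged, and induction treats the
  other vectors.\<close>

lemma sum_inner_le_sum_mu:
  fixes A :: "'a::complex_hilbert_space oper"
  assumes "separable TYPE('a)" "A \<in> bounded_ops" "orthonormal E" "finite E" "card E \<le> n"
  shows "(\<Sum>e\<in>E. inner (A e) e) \<le> (\<Sum>k<n. \<mu> (real k) A)"
  using assms(3-5)
proof (induction n arbitrary: E)
  case 0
  then show ?case by simp
next
  case (Suc n)
  show ?case
  proof (cases "card E \<le> n")
    case True
    then show ?thesis using Suc.IH[OF Suc.prems(1,2)] mu_nonneg[of "real n" A] by simp
  next
    case False
    show ?thesis
    proof (rule field_le_epsilon)
      fix \<epsilon> :: real assume "\<epsilon> > 0"
      then have "\<mu> (real n) A < \<mu> (real n) A + \<epsilon>" by simp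
      then obtain p where p: "projection p" "trace_op (id_blinfun - p) \<le> ennreal (real n)"
        "norm (A o\<^sub>L p) < \<mu> (real n) A + \<epsilon>" by (rule mu_less_obtain)
      obtain x where x: "x \<in> cvs.span E" "norm x = 1" "p x = x"
        using projection_fixes_unit[OF assms(1) p(1,2) Suc.prems(1,2)] False by auto
      have "inner (A x) x \<le> norm (A x) * norm x" by (rule norm_cauchy_schwarz)
      also have "\<dots> \<le> norm (A o\<^sub>L p)" using norm_blinfun[of "A o\<^sub>L p" x] x by simp
      finally have Ax: "inner (A x) x \<le> \<mu> (real n) A + \<epsilon>" using p(3) by simp
      have "orthonormal {x}" using orthonormal_insert[of "{}" x] x(2) by (simp add: orthonormal_def)
      then obtain F where F: "orthonormal F" "finite F" "{x} \<subseteq> F" "E \<subseteq> cvs.span F"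
        "F \<subseteq> cvs.span (E \<union> {x})"
        using gram_schmidt[OF Suc.prems(2), of "{x}"] by blast
      have "E \<union> {x} \<subseteq> cvs.span E" using x(1) by (auto intro: cvs.span_base)
      then have FE: "F \<subseteq> cvs.span E" using F(5) by (metis cvs.span_minimal cvs.subspace_span order_trans)
      \<comment> \<open>\<open>F\<close> stays inside the span of \<open>E\<close>, so completing
        \<open>{x}\<close> gains no vector, and at most \<open>n\<close> remain without
        \<open>x\<close>.\<close>
      have "card F \<le> card E" by (rule orthonormal_card_le[OF F(1,2) Suc.prems(2) FE])
      then have "card (F - {x}) \<le> n" using F(2,3) Suc.prems(3) by simp
      then have "(\<Sum>e\<in>F - {x}. inner (A e) e) \<le> (\<Sum>k<n. \<mu> (real k) A)"
        using F by (intro Suc.IH) (auto intro: orthonormal_subset)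
      moreover have "(\<Sum>e\<in>E. inner (A e) e) = inner (A x) x + (\<Sum>e\<in>F - {x}. inner (A e) e)"
        using sum_inner_basis_change[OF Suc.prems(1,2) F(1,2,4) FE assms(2)] F(2,3)
        by (simp add: sum.remove[of F x])
      ultimately show "(\<Sum>e\<in>E. inner (A e) e) \<le> (\<Sum>k<Suc n. \<mu> (real k) A) + \<epsilon>"
        using Ax by simp
    qed
  qed
qed

lemma inner_eq_0I:
  "cinner x y = 0 \<Longrightarrow> inner x y = 0"
  by (metis Re_cinner zero_complex.simps(1))

text \<open>Greedy choice of approximate eigenvectors: the next vector nearly maximises \<open>\<langle>Ax, x\<rangle>\<close> on the
  orthogonal complement of the previous ones. The last clause says that the span of \<open>E\<close> is almost
  invariant under \<open>A\<close>; it is what makes \<open>\<parallel>Ax\<parallel>\<close> comparable to \<open>\<langle>Ax, x\<rangle>\<close> on the complement.\<close>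

lemma exists_approx_eigenvectors:
  fixes A :: "'a::complex_hilbert_space oper"
  assumes "separable TYPE('a)" "infinite_dimensional TYPE('a)" "positive_op A" "0 < \<eta>"
  shows "\<exists>E. orthonormal E \<and> finite E \<and> card E = n \<and>
    (\<Sum>k<n. \<mu> (real k) A) \<le> (\<Sum>e\<in>E. inner (A e) e) + real (n * (n + 1)) * \<eta> \<and>
    (\<forall>e\<in>E. \<forall>y. (\<forall>f\<in>E. cinner y f = 0) \<longrightarrow> \<bar>inner (A e) y\<bar> \<le> \<eta> * norm y)"
proof (induction n)
  case 0
  then show ?case by (intro exI[of _ "{}"]) (simp add: orthonormal_def)
next
  case (Suc k)
  then obtain E where E: "orthonormal E" "finite E" "card E = k"
    and sumE: "(\<Sum>j<k. \<mu> (real j) A) \<le> (\<Sum>e\<in>E. inner (A e) e) + real (k * (k + 1)) * \<eta>"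
    and inv: "\<And>e y. e \<in> E \<Longrightarrow> (\<And>f. f \<in> E \<Longrightarrow> cinner y f = 0) \<Longrightarrow> \<bar>inner (A e) y\<bar> \<le> \<eta> * norm y"
    by blast
  define M where "M = {y. \<forall>f\<in>E. cinner y f = 0}"
  note pos = positive_op_nonneg[OF assms(3)] and sym = positive_op_symmetric[OF assms(3)]
  define S where "S = {inner (A x) x | x. x \<in> M \<and> norm x = 1}"
  define \<Lambda> where "\<Lambda> = Sup S"
  have AN: "inner (A x) x \<le> norm A" if "norm x = 1" for x
    using norm_cauchy_schwarz[of "A x" x] norm_blinfun[of A x] that by simp
  obtain x0 where "norm x0 = 1" "x0 \<in> M"
    using exists_unit_orthogonal[OF assms(2) E(1,2)] unfolding M_def by blast
  then have S_ne: "S \<noteq> {}" unfolding S_def by blast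
  have S_bdd: "bdd_above S" unfolding S_def using AN by (auto intro: bdd_aboveI[of _ "norm A"])
  have \<Lambda>_le: "\<Lambda> \<le> norm A"
    unfolding \<Lambda>_def by (rule cSup_least[OF S_ne]) (use AN in \<open>auto simp: S_def\<close>)
  have \<Lambda>_ge: "inner (A x) x \<le> \<Lambda> * (norm x)\<^sup>2" if "x \<in> M" for x
  proof (cases "x = 0")
    case True
    then show ?thesis by simp
  next
    case False
    define y where "y = inverse (norm x) *\<^sub>R x"
    have "y \<in> M" "norm y = 1"
      using that False by (simp_all add: y_def M_def scaleR_scaleC cinner_scaleC_left norm_scaleC norm_inverse)
    then have "inner (A y) y \<le> \<Lambda>" unfolding \<Lambda>_def S_def by (intro cSup_upper S_bdd[unfolded S_def]) blast
    then have "inner (A x) x / (norm x)\<^sup>2 \<le> \<Lambda>"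
      by (simp add: y_def blinfun.scaleR_right power2_eq_square divide_inverse ac_simps)
    then show ?thesis using False by (simp add: field_simps)
  qed
  have \<Lambda>0: "0 \<le> \<Lambda>"
    using \<Lambda>_ge[OF \<open>x0 \<in> M\<close>] pos[of x0] \<open>norm x0 = 1\<close> by simp
  \<comment> \<open>\<open>\<delta> \<le> \<eta>\<close> limits the loss in the sum, and
    \<open>\<delta> * \<Lambda> \<le> \<eta>\<^sup>2\<close> limits the off-diagonal entries. The
    \<open>+ 1\<close> covers \<open>A = 0\<close>.\<close>
  define \<delta> where "\<delta> = min \<eta> (\<eta>\<^sup>2 / (norm A + 1))"
  have \<delta>: "0 < \<delta>" "\<delta> \<le> \<eta>" using assms(4) by (simp_all add: \<delta>_def add_nonneg_pos)
  have "\<delta> * \<Lambda> \<le> \<delta> * (norm A + 1)" using \<Lambda>_le \<delta> by (intro mult_left_mono) auto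
  also have "\<dots> \<le> \<eta>\<^sup>2 / (norm A + 1) * (norm A + 1)" by (intro mult_right_mono) (auto simp: \<delta>_def)
  also have "\<dots> = \<eta>\<^sup>2" using norm_ge_zero[of A] by (simp add: add_nonneg_pos less_imp_neq[symmetric])
  finally have \<delta>\<Lambda>: "\<delta> * \<Lambda> \<le> \<eta>\<^sup>2" .
  have "\<Lambda> - \<delta> < Sup S" using \<delta> by (simp add: \<Lambda>_def)
  then obtain e where e: "e \<in> M" "norm e = 1" "\<Lambda> - \<delta> < inner (A e) e"
    using less_cSup_iff[OF S_ne S_bdd] unfolding S_def by blast
  have eE: "e \<notin> E" using e(1,2) cinner_self[of e] unfolding M_def by force
  have onE': "orthonormal (insert e E)" by (rule orthonormal_insert[OF E(1) e(2)]) (use e(1) M_def in auto)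

  \<comment> \<open>Cauchy-Schwarz for the form of \<open>T\<close>, which is
    \<open>\<Lambda>\<close> minus \<open>A\<close>: near-maximality makes its value at
    \<open>e\<close> at most \<open>\<delta>\<close>, while at \<open>y\<close> it is at most
    \<open>\<Lambda> * (norm y)\<^sup>2\<close>.\<close>
  have inv_e: "\<bar>inner (A e) y\<bar> \<le> \<eta> * norm y" if y: "y \<in> M" "cinner y e = 0" for y
  proof -
    define T where "T = \<Lambda> *\<^sub>R id_blinfun - A"
    have T: "T u = \<Lambda> *\<^sub>R u - A u" for u by (simp add: T_def blinfun.diff_left blinfun.scaleR_left)
    have T_pos: "0 \<le> inner (T u) u" if "u \<in> M" for u
      using \<Lambda>_ge[OF that] by (simp add: T inner_diff_left power2_norm_eq_inner)
    have "(inner (T e) y)\<^sup>2 \<le> inner (T e) e * inner (T y) y"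
    proof (rule symmetric_form_cauchy_schwarz)
      show "inner (T u) v = inner u (T v)" for u v
        by (simp add: T inner_diff_left inner_diff_right sym)
      have "e + t *\<^sub>R y \<in> M" for t
        using e(1) y(1) by (simp add: M_def cinner_add_left scaleR_scaleC cinner_scaleC_left)
      then show "0 \<le> inner (T (e + t *\<^sub>R y)) (e + t *\<^sub>R y)" for t by (rule T_pos)
      show "0 \<le> inner (T y) y" by (rule T_pos[OF y(1)])
    qed
    moreover have "inner (T e) y = - inner (A e) y"
      using inner_eq_0I[OF y(2)] inner_commute[of e y] by (simp add: T inner_diff_left)
    moreover have "inner (T e) e \<le> \<delta>"
      using e(2,3) by (simp add: T inner_diff_left power2_norm_eq_inner[symmetric])
    moreover have "inner (T y) y \<le> \<Lambda> * (norm y)\<^sup>2"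
      using pos[of y] by (simp add: T inner_diff_left power2_norm_eq_inner[symmetric])
    ultimately have "(inner (A e) y)\<^sup>2 \<le> \<delta> * (\<Lambda> * (norm y)\<^sup>2)"
      using mult_mono[of "inner (T e) e" \<delta> "inner (T y) y" "\<Lambda> * (norm y)\<^sup>2"] \<delta> T_pos[OF y(1)]
      by simp
    also have "\<dots> \<le> \<eta>\<^sup>2 * (norm y)\<^sup>2" using mult_right_mono[OF \<delta>\<Lambda>, of "(norm y)\<^sup>2"] by (simp add: ac_simps)
    finally have "\<bar>inner (A e) y\<bar>\<^sup>2 \<le> (\<eta> * norm y)\<^sup>2" by (simp add: power_mult_distrib)
    then show ?thesis by (rule power2_le_imp_le) (use assms(4) in simp)
  qed

  \<comment> \<open>For \<open>x\<close> in \<open>M\<close>, each of the \<open>k\<close> vectors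
    of \<open>E\<close> receives at most \<open>\<eta> * norm x\<close> of \<open>A x\<close>, by
    almost invariance. The remaining part \<open>z\<close> lies in \<open>M\<close>, and
    Cauchy-Schwarz for \<open>A\<close> bounds the fourth power of \<open>norm z\<close>, which is
    \<open>(inner (A x) z)\<^sup>2\<close>, by
    \<open>\<Lambda>\<^sup>2 * (norm x)\<^sup>2 * (norm z)\<^sup>2\<close>.\<close>
  have "\<mu> (real k) A \<le> \<Lambda> + real k * \<eta>"
  proof (rule mu_le_compl_proj[OF assms(1) E(1,2)])
    fix x assume "\<And>f. f \<in> E \<Longrightarrow> cinner x f = 0"
    then have x: "x \<in> M" by (simp add: M_def)
    define z where "z = A x - proj_span E (A x)"
    have zM: "z \<in> M" by (simp add: M_def z_def cinner_diff_left cinner_proj_span E)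
    have cAf: "cmod (cinner (A x) f) \<le> \<eta> * norm x" if f: "f \<in> E" for f
    proof -
      have "cmod (cinner (A f) x) \<le> \<eta> * norm x"
        by (rule cmod_cinner_le, rule inv[OF f]) (use x in \<open>simp add: M_def cinner_scaleC_left\<close>)
      then show ?thesis by (metis positive_op_hermitian[OF assms(3)] cmod_cinner_commute)
    qed
    have "norm (proj_span E (A x)) \<le> (\<Sum>f\<in>E. norm (scaleC (cinner (A x) f) f))"
      unfolding proj_span_def by (rule norm_sum)
    also have "\<dots> \<le> (\<Sum>f\<in>E. \<eta> * norm x)"
      using cAf orthonormal_norm[OF E(1)] by (intro sum_mono) (simp add: norm_scaleC)
    finally have P: "norm (proj_span E (A x)) \<le> real k * \<eta> * norm x" by (simp add: E(3))
    have "cinner (proj_span E (A x)) z = 0"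
      by (rule cinner_span_eq_0[OF proj_span_in_span]) (use zM M_def cinner_eq_0_commute in blast)
    then have "inner (A x) z = (norm z)\<^sup>2"
      using inner_eq_0I[of "proj_span E (A x)" z] by (simp add: z_def inner_diff_left power2_norm_eq_inner)
    then have "((norm z)\<^sup>2)\<^sup>2 \<le> inner (A x) x * inner (A z) z"
      using symmetric_form_cauchy_schwarz[of A x z] sym pos by simp
    also have "\<dots> \<le> (\<Lambda> * (norm x)\<^sup>2) * (\<Lambda> * (norm z)\<^sup>2)"
      using \<Lambda>0 by (intro mult_mono \<Lambda>_ge x zM pos) auto
    finally have zz: "(norm z)\<^sup>2 * (norm z)\<^sup>2 \<le> (\<Lambda> * norm x)\<^sup>2 * (norm z)\<^sup>2"
      by (simp add: power2_eq_square ac_simps)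
    have "norm z \<le> \<Lambda> * norm x"
    proof (cases "z = 0")
      case False
      then have "(norm z)\<^sup>2 \<le> (\<Lambda> * norm x)\<^sup>2"
        using mult_right_le_imp_le[OF zz] by simp
      then show ?thesis by (rule power2_le_imp_le) (use \<Lambda>0 in simp)
    qed (use \<Lambda>0 in simp)
    then show "norm (A x) \<le> (\<Lambda> + real k * \<eta>) * norm x"
      using P norm_triangle_ineq[of z "proj_span E (A x)"] by (simp add: z_def algebra_simps)
  qed (use E(3) \<Lambda>0 assms(4) in auto)
  then have "\<mu> (real k) A \<le> inner (A e) e + \<eta> + real k * \<eta>" using e(3) \<delta>(2) by simp
  \<comment> \<open>The new vector costs \<open>(k + 1) * \<eta>\<close>. These costs add up to half
    of \<open>n * (n + 1) * \<eta>\<close>; the cruder constant avoids fractions.\<close>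
  moreover have "real (k * (k + 1)) * \<eta> + \<eta> + real k * \<eta> \<le> real (Suc k * (Suc k + 1)) * \<eta>"
    using assms(4) by (simp add: algebra_simps)
  ultimately have "(\<Sum>j<Suc k. \<mu> (real j) A) \<le>
      (\<Sum>f\<in>insert e E. inner (A f) f) + real (Suc k * (Suc k + 1)) * \<eta>"
    using sumE eE E(2) by simp
  moreover have "\<bar>inner (A f) y\<bar> \<le> \<eta> * norm y"
    if "f \<in> insert e E" "\<forall>g\<in>insert e E. cinner y g = 0" for f y
    using that inv[of f y] inv_e[of y] by (auto simp: M_def)
  ultimately show ?case using onE' E eE by (intro exI[of _ "insert e E"]) auto
qed

lemma exists_orthonormal_sum_inner_ge:
  fixes A :: "'a::complex_hilbert_space oper"
  assumes "separable TYPE('a)" "infinite_dimensional TYPE('a)" "positive_op A" "0 < \<epsilon>"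
  shows "\<exists>E. orthonormal E \<and> finite E \<and> card E = n \<and>
    (\<Sum>k<n. \<mu> (real k) A) \<le> (\<Sum>e\<in>E. inner (A e) e) + \<epsilon>"
proof -
  define \<eta> where "\<eta> = \<epsilon> / (real (n * (n + 1)) + 1)"
  have "0 < \<eta>" using assms(4) by (simp add: \<eta>_def add_nonneg_pos)
  moreover have "(real (n * (n + 1)) + 1) * \<eta> = \<epsilon>" by (simp add: \<eta>_def add_nonneg_pos less_imp_neq[symmetric])
  then have "real (n * (n + 1)) * \<eta> \<le> \<epsilon>" using \<open>0 < \<eta>\<close> by (simp add: algebra_simps)
  ultimately show ?thesis using exists_approx_eigenvectors[OF assms(1-3), of \<eta> n] by fastforce
qed

lemma sum_mu_subadditive:
  fixes A B :: "'a::complex_hilbert_space oper"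
  assumes "separable TYPE('a)" "infinite_dimensional TYPE('a)" "positive_op A" "positive_op B"
  shows "(\<Sum>k<n. \<mu> (real k) (A + B)) \<le> (\<Sum>k<n. \<mu> (real k) A) + (\<Sum>k<n. \<mu> (real k) B)"
proof (rule field_le_epsilon)
  fix \<epsilon> :: real assume "\<epsilon> > 0"
  have bo: "A \<in> bounded_ops" "B \<in> bounded_ops" using assms(3,4) unfolding positive_op_def by auto
  obtain E where E: "orthonormal E" "finite E" "card E = n"
    "(\<Sum>k<n. \<mu> (real k) (A + B)) \<le> (\<Sum>e\<in>E. inner ((A + B) e) e) + \<epsilon>"
    using exists_orthonormal_sum_inner_ge[OF assms(1,2) positive_op_add[OF assms(3,4)] \<open>\<epsilon> > 0\<close>] by blast
  then show "(\<Sum>k<n. \<mu> (real k) (A + B)) \<le> (\<Sum>k<n. \<mu> (real k) A) + (\<Sum>k<n. \<mu> (real k) B) + \<epsilon>"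
    using sum_inner_le_sum_mu[OF assms(1) bo(1) E(1,2), of n] sum_inner_le_sum_mu[OF assms(1) bo(2) E(1,2), of n]
    by (simp add: blinfun.add_left inner_add_left sum.distrib)
qed

text \<open>Nearly optimal systems \<open>E\<close> for \<open>A\<close> and \<open>F\<close> for
  \<open>B\<close> together span at most \<open>2 * n\<close> dimensions. Since \<open>E\<close> and
  \<open>F\<close> need not fit into one orthonormal set, the joint span gets two bases,
  \<open>G\<close> containing \<open>E\<close> and \<open>H\<close> containing \<open>F\<close>.
  Positivity allows the enlargement, and basis independence moves the sum for \<open>B\<close> from
  \<open>H\<close> to \<open>G\<close>.\<close>

lemma sum_mu_superadditive:
  fixes A B :: "'a::complex_hilbert_space oper"
  assumes "separable TYPE('a)" "infinite_dimensional TYPE('a)" "positive_op A" "positive_op B"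
  shows "(\<Sum>k<n. \<mu> (real k) A) + (\<Sum>k<n. \<mu> (real k) B) \<le> (\<Sum>k<2 * n. \<mu> (real k) (A + B))"
proof (rule field_le_epsilon)
  fix \<epsilon> :: real assume "\<epsilon> > 0"
  then have "\<epsilon> / 2 > 0" by simp
  have AB: "A + B \<in> bounded_ops" "B \<in> bounded_ops"
    using positive_op_add[OF assms(3,4)] assms(4) unfolding positive_op_def by auto
  obtain E where E: "orthonormal E" "finite E" "card E = n"
    "(\<Sum>k<n. \<mu> (real k) A) \<le> (\<Sum>e\<in>E. inner (A e) e) + \<epsilon> / 2"
    using exists_orthonormal_sum_inner_ge[OF assms(1-3) \<open>\<epsilon> / 2 > 0\<close>] by blast
  obtain F where F: "orthonormal F" "finite F" "card F = n"
    "(\<Sum>k<n. \<mu> (real k) B) \<le> (\<Sum>e\<in>F. inner (B e) e) + \<epsilon> / 2"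
    using exists_orthonormal_sum_inner_ge[OF assms(1,2,4) \<open>\<epsilon> / 2 > 0\<close>] by blast
  obtain G where G: "orthonormal G" "finite G" "E \<subseteq> G" "F \<subseteq> cvs.span G" "G \<subseteq> cvs.span (F \<union> E)"
    "card G \<le> 2 * n"
    using gram_schmidt[OF F(2) E(1,2)] E(3) F(3) by auto
  obtain H where H: "orthonormal H" "finite H" "F \<subseteq> H" "E \<subseteq> cvs.span H" "H \<subseteq> cvs.span (E \<union> F)"
    using gram_schmidt[OF E(2) F(1,2)] by blast
  have "E \<union> F \<subseteq> cvs.span G" "F \<union> E \<subseteq> cvs.span H" using G H by (auto intro: cvs.span_base)
  then have "H \<subseteq> cvs.span G" "G \<subseteq> cvs.span H"
    using G(5) H(5) by (metis cvs.span_minimal cvs.subspace_span order_trans)+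
  then have HG: "(\<Sum>e\<in>H. inner (B e) e) = (\<Sum>e\<in>G. inner (B e) e)"
    using sum_inner_basis_change[OF H(1,2) G(1,2)] AB(2) by blast
  have "(\<Sum>e\<in>E. inner (A e) e) \<le> (\<Sum>e\<in>G. inner (A e) e)"
    using G positive_op_nonneg[OF assms(3)] by (intro sum_mono2) auto
  moreover have "(\<Sum>e\<in>F. inner (B e) e) \<le> (\<Sum>e\<in>H. inner (B e) e)"
    using H positive_op_nonneg[OF assms(4)] by (intro sum_mono2) auto
  ultimately have "(\<Sum>e\<in>E. inner (A e) e) + (\<Sum>e\<in>F. inner (B e) e) \<le> (\<Sum>e\<in>G. inner ((A + B) e) e)"
    using HG by (simp add: blinfun.add_left inner_add_left sum.distrib)
  also have "\<dots> \<le> (\<Sum>k<2 * n. \<mu> (real k) (A + B))"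
    by (rule sum_inner_le_sum_mu[OF assms(1) AB(1) G(1,2,6)])
  finally show "(\<Sum>k<n. \<mu> (real k) A) + (\<Sum>k<n. \<mu> (real k) B)
      \<le> (\<Sum>k<2 * n. \<mu> (real k) (A + B)) + \<epsilon>"
    using E(4) F(4) by simp
qed

section \<open>Diagonal operators\<close>

definition diag_sum :: "(nat \<Rightarrow> 'a::complex_hilbert_space) \<Rightarrow> (nat \<Rightarrow> real) \<Rightarrow> nat \<Rightarrow> 'a \<Rightarrow> 'a" where
  "diag_sum c a n x = (\<Sum>j<n. scaleC (a j * cinner x (c j)) (c j))"

text \<open>The limit is taken at each vector, since \<open>a\<close> need not tend to 0 and the
  series need not converge in operator norm.\<close>

definition diag_op :: "(nat \<Rightarrow> 'a::complex_hilbert_space) \<Rightarrow> (nat \<Rightarrow> real) \<Rightarrow> 'a oper" where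
  "diag_op c a = Blinfun (\<lambda>x. lim (\<lambda>n. diag_sum c a n x))"

lemma norm_sum_orthonormal_sequence:
  assumes "orthonormal (range c)" "inj c" "finite J"
  shows "(norm (\<Sum>j\<in>J. scaleC (u j) (c j)))\<^sup>2 = (\<Sum>j\<in>J. (cmod (u j))\<^sup>2)"
proof -
  have "orthonormal (c ` J)" using assms(1) by (rule orthonormal_subset) auto
  from norm_linear_combination[OF this, of "\<lambda>f. u (inv c f)"] assms
  show ?thesis by (simp add: sum.reindex inj_on_subset[of c UNIV] inv_f_f)
qed

lemma bessel_sequence:
  assumes "orthonormal (range c)" "inj c" "finite J"
  shows "(\<Sum>j\<in>J. (cmod (cinner x (c j)))\<^sup>2) \<le> (norm x)\<^sup>2"
proof -
  have "orthonormal (c ` J)" using assms(1) by (rule orthonormal_subset) auto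
  from bessel[OF this, of x] assms show ?thesis by (simp add: sum.reindex inj_on_subset[of c UNIV])
qed

context
  fixes c :: "nat \<Rightarrow> 'a::complex_hilbert_space" and a :: "nat \<Rightarrow> real"
  assumes c: "orthonormal (range c)" "inj c"
    and a: "decseq a" "\<And>n. 0 \<le> a n"
begin

lemma norm_diag_sum_block:
  assumes "\<And>j. j \<in> J \<Longrightarrow> k \<le> j" "finite J"
  shows "(norm (\<Sum>j\<in>J. scaleC (a j * cinner x (c j)) (c j)))\<^sup>2 \<le> (a k)\<^sup>2 * (\<Sum>j\<in>J. (cmod (cinner x (c j)))\<^sup>2)"
  unfolding norm_sum_orthonormal_sequence[OF c assms(2)] sum_distrib_left
  using assms(1) a decseqD[OF a(1), of k]
  by (intro sum_mono) (simp add: norm_mult power_mult_distrib mult_right_mono power_mono)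

lemma convergent_diag_sum: "convergent (\<lambda>n. diag_sum c a n x)"
proof -
  let ?f = "\<lambda>j. (cmod (cinner x (c j)))\<^sup>2"
  have "summable ?f"
    by (rule summableI_nonneg_bounded[of _ "(norm x)\<^sup>2"]) (simp_all add: bessel_sequence[OF c])
  have "Cauchy (\<lambda>n. diag_sum c a n x)"
  proof (rule CauchyI')
    fix e :: real assume e: "e > 0"
    \<comment> \<open>The \<open>+ 1\<close> permits the division when
      \<open>a 0 = 0\<close>.\<close>
    have a1: "0 < (a 0)\<^sup>2 + 1" by (simp add: add_nonneg_pos)
    then have "0 < e\<^sup>2 / ((a 0)\<^sup>2 + 1)" using e by simp
    then obtain N where N: "\<And>m n. m \<ge> N \<Longrightarrow> norm (sum ?f {m..<n}) < e\<^sup>2 / ((a 0)\<^sup>2 + 1)"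
      using \<open>summable ?f\<close> unfolding summable_Cauchy by blast
    have "norm (diag_sum c a m x - diag_sum c a n x) < e" if "m \<ge> N" "m < n" for m n
    proof -
      have "diag_sum c a n x - diag_sum c a m x = (\<Sum>j\<in>{m..<n}. scaleC (a j * cinner x (c j)) (c j))"
        unfolding diag_sum_def using that(2) sum_diff_nat_ivl[of 0 m n] by (simp add: lessThan_atLeast0)
      then have "(norm (diag_sum c a m x - diag_sum c a n x))\<^sup>2 \<le> (a 0)\<^sup>2 * sum ?f {m..<n}"
        using norm_diag_sum_block[of "{m..<n}" 0 x] by (simp add: norm_minus_commute[of "diag_sum c a m x"])
      also have "\<dots> \<le> ((a 0)\<^sup>2 + 1) * sum ?f {m..<n}" by (intro mult_right_mono sum_nonneg) auto
      also have "\<dots> < e\<^sup>2" using N[OF that(1), of n] a1 by (simp add: field_simps abs_of_nonneg sum_nonneg)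
      finally show ?thesis using e by (simp add: power2_less_imp_less)
    qed
    then show "\<exists>M. \<forall>m\<ge>M. \<forall>n>m. dist (diag_sum c a m x) (diag_sum c a n x) < e"
      unfolding dist_norm by blast
  qed
  then show ?thesis by (rule Cauchy_convergent)
qed

text \<open>\<open>k = 0\<close> gives boundedness of the limit operator; general \<open>k\<close>
  gives the upper bound on its singular values.\<close>

lemma norm_diag_sum_le:
  assumes "\<And>j. j < k \<Longrightarrow> cinner x (c j) = 0"
  shows "norm (diag_sum c a n x) \<le> a k * norm x"
proof (rule power2_le_imp_le)
  have "diag_sum c a n x = (\<Sum>j\<in>{k..<n}. scaleC (a j * cinner x (c j)) (c j))"
    unfolding diag_sum_def
    by (rule sum.mono_neutral_right) (use assms in \<open>auto simp: not_le\<close>)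
  then have "(norm (diag_sum c a n x))\<^sup>2 \<le> (a k)\<^sup>2 * (\<Sum>j\<in>{k..<n}. (cmod (cinner x (c j)))\<^sup>2)"
    using norm_diag_sum_block[of "{k..<n}" k x] by simp
  also have "\<dots> \<le> (a k)\<^sup>2 * (norm x)\<^sup>2"
    by (intro mult_left_mono bessel_sequence[OF c]) auto
  finally show "(norm (diag_sum c a n x))\<^sup>2 \<le> (a k * norm x)\<^sup>2" by (simp add: power_mult_distrib)
qed (use a in simp)

lemma diag_op_tendsto: "(\<lambda>n. diag_sum c a n x) \<longlonglongrightarrow> diag_op c a x"
proof -
  let ?D = "\<lambda>x. lim (\<lambda>n. diag_sum c a n x)"
  have lim: "(\<lambda>n. diag_sum c a n x) \<longlonglongrightarrow> ?D x" for x
    using convergent_diag_sum by (simp add: convergent_LIMSEQ_iff)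
  have "bounded_linear ?D"
  proof (rule bounded_linear_intro)
    fix x y r
    have "diag_sum c a n (x + y) = diag_sum c a n x + diag_sum c a n y" for n
      by (simp add: diag_sum_def cinner_add_left distrib_left scaleC_add_left sum.distrib)
    then show "?D (x + y) = ?D x + ?D y"
      using LIMSEQ_unique[OF lim[of "x + y"]] tendsto_add[OF lim[of x] lim[of y]] by simp
    have "diag_sum c a n (r *\<^sub>R x) = r *\<^sub>R diag_sum c a n x" for n
      by (simp add: diag_sum_def scaleR_scaleC cinner_scaleC_left cvs.scale_sum_right scaleC_scaleC ac_simps)
    then show "?D (r *\<^sub>R x) = r *\<^sub>R ?D x"
      using LIMSEQ_unique[OF lim[of "r *\<^sub>R x"]] tendsto_scaleR[OF tendsto_const lim[of x]] by simp
    show "norm (?D x) \<le> norm x * a 0"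
      by (rule LIMSEQ_le_const2[OF tendsto_norm[OF lim]]) (use norm_diag_sum_le[of 0] in \<open>auto simp: mult.commute\<close>)
  qed
  then show ?thesis using lim by (simp add: diag_op_def bounded_linear_Blinfun_apply)
qed

lemma positive_op_diag_op: "positive_op (diag_op c a)"
  unfolding positive_op_def bounded_ops_def
proof (intro conjI CollectI allI)
  fix x and r
  \<comment> \<open>Complex scaling is written as a bounded operator so that its continuity is at
    hand for the limit.\<close>
  have "diag_sum c a n (scaleC r x) = scale_op r id_blinfun (diag_sum c a n x)" for n
    by (simp add: scale_op_apply diag_sum_def cinner_scaleC_left cvs.scale_sum_right scaleC_scaleC ac_simps)
  moreover have "(\<lambda>n. scale_op r id_blinfun (diag_sum c a n x)) \<longlonglongrightarrow> scale_op r id_blinfun (diag_op c a x)"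
    by (rule bounded_linear.tendsto[OF blinfun.bounded_linear_right diag_op_tendsto])
  ultimately show "diag_op c a (scaleC r x) = scaleC r (diag_op c a x)"
    using LIMSEQ_unique[OF diag_op_tendsto[of "scaleC r x"]] by (simp add: scale_op_apply)
next
  fix x
  have *: "cinner (diag_sum c a n x) x = complex_of_real (\<Sum>j<n. a j * (cmod (cinner x (c j)))\<^sup>2)" for n
    by (simp add: diag_sum_def cinner_sum_left cinner_scaleC_left complex_norm_square mult.assoc
        cinner_commute[symmetric] del: of_real_power)
  have "inner (diag_sum c a n x) x \<ge> 0" for n
    using a by (simp add: Re_cinner[symmetric] * sum_nonneg)
  then have "inner (diag_op c a x) x \<ge> 0"
    by (intro LIMSEQ_le_const[OF tendsto_inner[OF diag_op_tendsto tendsto_const]]) auto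
  \<comment> \<open>The imaginary part is a real inner product with \<open>scaleC \<i> x\<close>, so
    it too passes to the limit.\<close>
  moreover have "inner (diag_sum c a n x) (scaleC \<i> x) = 0" for n
    by (simp add: Im_cinner[symmetric] *)
  then have "inner (diag_op c a x) (scaleC \<i> x) = 0"
    using tendsto_inner[OF diag_op_tendsto[of x] tendsto_const, of "scaleC \<i> x"] LIMSEQ_unique[OF tendsto_const]
    by fastforce
  ultimately show "cinner (diag_op c a x) x \<in> \<real>\<^sub>\<ge>\<^sub>0"
    by (simp add: complex_nonneg_Reals_iff Re_cinner Im_cinner)
qed

text \<open>The test spaces are the complement of the first \<open>k\<close> vectors for the upper
  bound and the span of the first \<open>k + 1\<close> for the lower one.\<close>

lemma mu_diag_op:
  assumes "separable TYPE('a)"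
  shows "\<mu> (real k) (diag_op c a) = a k"
proof (rule antisym)
  have on: "orthonormal (c ` J)" for J using c(1) by (rule orthonormal_subset) auto
  have card: "card (c ` J) = card J" for J using c(2) by (simp add: card_image inj_on_subset[of c UNIV])
  show "\<mu> (real k) (diag_op c a) \<le> a k"
  proof (rule mu_le_compl_proj[OF assms on])
    fix x assume "\<And>e. e \<in> c ` {..<k} \<Longrightarrow> cinner x e = 0"
    then have "\<And>n. norm (diag_sum c a n x) \<le> a k * norm x" by (intro norm_diag_sum_le) auto
    then show "norm (diag_op c a x) \<le> a k * norm x"
      by (intro LIMSEQ_le_const2[OF tendsto_norm[OF diag_op_tendsto]]) auto
  qed (use a in \<open>auto simp: card\<close>)
  show "a k \<le> \<mu> (real k) (diag_op c a)"
  proof (rule mu_ge_span[OF assms on[of "{..k}"]])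
    fix x assume x: "x \<in> cvs.span (c ` {..k})" "norm x = 1"
    have "x = (\<Sum>j\<le>k. scaleC (cinner x (c j)) (c j))"
      using proj_span_eq[OF on _ x(1)] c(2)
      by (simp add: proj_span_def sum.reindex inj_on_subset[of c UNIV])
    then have x1: "1 = (\<Sum>j\<le>k. (cmod (cinner x (c j)))\<^sup>2)"
      using norm_sum_orthonormal_sequence[OF c, of "{..k}" "\<lambda>j. cinner x (c j)"] x(2) by simp
    have "a k \<le> norm (diag_sum c a n x)" if "n > k" for n
    proof (rule power2_le_imp_le)
      have "(a k)\<^sup>2 = (\<Sum>j\<le>k. (a k)\<^sup>2 * (cmod (cinner x (c j)))\<^sup>2)"
        using x1 by (simp add: sum_distrib_left[symmetric])
      also have "\<dots> \<le> (\<Sum>j\<le>k. (a j)\<^sup>2 * (cmod (cinner x (c j)))\<^sup>2)"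
        using a decseqD[OF a(1)] by (intro sum_mono mult_right_mono power_mono) auto
      also have "\<dots> \<le> (\<Sum>j<n. (a j)\<^sup>2 * (cmod (cinner x (c j)))\<^sup>2)"
        using that by (intro sum_mono2) auto
      also have "\<dots> = (norm (diag_sum c a n x))\<^sup>2"
        unfolding diag_sum_def by (simp add: norm_sum_orthonormal_sequence[OF c] norm_mult power_mult_distrib)
      finally show "(a k)\<^sup>2 \<le> (norm (diag_sum c a n x))\<^sup>2" .
    qed simp
    then show "a k \<le> norm (diag_op c a x)"
      by (intro LIMSEQ_le_const[OF tendsto_norm[OF diag_op_tendsto]] exI[of _ "Suc k"]) auto
  qed (auto simp: card)
qed

end

text \<open>The two partial sums of length \<open>n\<close> interleave to the partial sum of length
  \<open>2 * n\<close>, so the limits agree along a subsequence.\<close>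

lemma diag_op_add_even_odd:
  fixes c :: "nat \<Rightarrow> 'a::complex_hilbert_space"
  assumes "orthonormal (range c)" "inj c" "decseq a" "\<And>n. 0 \<le> a n"
  shows "diag_op (\<lambda>j. c (2 * j)) a + diag_op (\<lambda>j. c (2 * j + 1)) a = diag_op c (\<lambda>j. a (j div 2))"
proof (rule blinfun_eqI)
  fix x
  have "orthonormal (range (\<lambda>j. c (2 * j)))" "orthonormal (range (\<lambda>j. c (2 * j + 1)))"
    using assms(1) by (auto intro: orthonormal_subset)
  moreover have "inj (\<lambda>j. c (2 * j))" "inj (\<lambda>j. c (2 * j + 1))"
    using assms(2) by (auto simp: inj_eq intro!: injI)
  ultimately have "(\<lambda>n. diag_sum (\<lambda>j. c (2 * j)) a n x + diag_sum (\<lambda>j. c (2 * j + 1)) a n x) \<longlonglongrightarrow>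
      diag_op (\<lambda>j. c (2 * j)) a x + diag_op (\<lambda>j. c (2 * j + 1)) a x"
    using assms(3,4) by (intro tendsto_add diag_op_tendsto) auto
  moreover have "diag_sum (\<lambda>j. c (2 * j)) a n x + diag_sum (\<lambda>j. c (2 * j + 1)) a n x =
      diag_sum c (\<lambda>j. a (j div 2)) (2 * n) x" for n
    by (induction n) (simp_all add: diag_sum_def algebra_simps)
  moreover have "decseq (\<lambda>j. a (j div 2))"
    using assms(3) by (simp add: decseq_def div_le_mono)
  then have "(\<lambda>n. diag_sum c (\<lambda>j. a (j div 2)) n x) \<longlonglongrightarrow> diag_op c (\<lambda>j. a (j div 2)) x"
    by (intro diag_op_tendsto assms)
  then have "(\<lambda>n. diag_sum c (\<lambda>j. a (j div 2)) (2 * n) x) \<longlonglongrightarrow> diag_op c (\<lambda>j. a (j div 2)) x"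
    by (rule LIMSEQ_subseq_LIMSEQ[unfolded comp_def]) (simp add: strict_mono_def)
  ultimately show "(diag_op (\<lambda>j. c (2 * j)) a + diag_op (\<lambda>j. c (2 * j + 1)) a) x = diag_op c (\<lambda>j. a (j div 2)) x"
    using LIMSEQ_unique by (simp add: blinfun.add_left)
qed

section \<open>States and their extension to unbounded sequences\<close>

definition real_state :: "((nat \<Rightarrow> complex) \<Rightarrow> complex) \<Rightarrow> (nat \<Rightarrow> real) \<Rightarrow> real" where
  "real_state \<omega> y = Re (\<omega> (\<lambda>n. complex_of_real (y n)))"

lemma of_real_in_l_infty: "bounded (range y) \<Longrightarrow> (\<lambda>n. complex_of_real (y n)) \<in> l_infty"
  by (auto simp: l_infty_def bounded_iff)

lemma bounded_range_nonneg:
  fixes y :: "nat \<Rightarrow> real"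
  assumes "\<And>n. 0 \<le> y n" "\<And>n. y n \<le> K"
  shows "bounded (range y)"
  using assms by (auto simp: bounded_iff intro!: exI[of _ K])

lemma bounded_range_add:
  fixes y z :: "nat \<Rightarrow> real"
  assumes "bounded (range y)" "bounded (range z)"
  shows "bounded (range (\<lambda>n. y n + z n))"
proof -
  obtain K L where "\<And>n. \<bar>y n\<bar> \<le> K" "\<And>n. \<bar>z n\<bar> \<le> L" using assms by (auto simp: bounded_iff)
  then have "\<bar>y n + z n\<bar> \<le> K + L" for n by (meson abs_triangle_ineq add_mono order_trans)
  then show ?thesis by (auto simp: bounded_iff)
qed

lemma bounded_range_cmult:
  fixes y :: "nat \<Rightarrow> real"
  assumes "bounded (range y)"
  shows "bounded (range (\<lambda>n. r * y n))"
  using bounded_scaling[OF assms, of r] by (simp add: image_image)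

context
  fixes \<omega> :: "(nat \<Rightarrow> complex) \<Rightarrow> complex"
  assumes state: "state \<omega>"
begin

lemma real_state_add:
  "bounded (range y) \<Longrightarrow> bounded (range z) \<Longrightarrow> real_state \<omega> (\<lambda>n. y n + z n) = real_state \<omega> y + real_state \<omega> z"
  using state of_real_in_l_infty[of y] of_real_in_l_infty[of z] by (simp add: real_state_def state_def)

lemma real_state_cmult:
  "bounded (range y) \<Longrightarrow> real_state \<omega> (\<lambda>n. r * y n) = r * real_state \<omega> y"
  using state of_real_in_l_infty[of y] by (simp add: real_state_def state_def)

lemma real_state_const: "real_state \<omega> (\<lambda>_. r) = r"
  using real_state_cmult[of "\<lambda>_. 1" r] state by (simp add: real_state_def state_def)

lemma state_of_nonneg:
  assumes "bounded (range y)" "\<And>n. 0 \<le> y n"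
  shows "\<omega> (\<lambda>n. complex_of_real (y n)) = complex_of_real (real_state \<omega> y)" "0 \<le> real_state \<omega> y"
proof -
  have "\<omega> (\<lambda>n. complex_of_real (y n)) \<in> \<real>\<^sub>\<ge>\<^sub>0"
    using state of_real_in_l_infty[OF assms(1)] assms(2) by (simp add: state_def)
  then show "\<omega> (\<lambda>n. complex_of_real (y n)) = complex_of_real (real_state \<omega> y)" "0 \<le> real_state \<omega> y"
    by (simp_all add: complex_nonneg_Reals_iff real_state_def complex_eq_iff)
qed

lemma real_state_mono:
  assumes "bounded (range y)" "bounded (range z)" "\<And>n. y n \<le> z n"
  shows "real_state \<omega> y \<le> real_state \<omega> z"
proof -
  have b: "bounded (range (\<lambda>n. z n + - 1 * y n))"
    by (intro bounded_range_add bounded_range_cmult assms)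
  have "0 \<le> real_state \<omega> (\<lambda>n. z n + - 1 * y n)"
    by (rule state_of_nonneg(2)[OF b]) (simp add: assms)
  also have "\<dots> = real_state \<omega> z + - 1 * real_state \<omega> y"
    by (simp only: real_state_add[OF assms(2) bounded_range_cmult[OF assms(1)]] real_state_cmult[OF assms(1)])
  finally show ?thesis by simp
qed

section \<open>The extension as a supremum over bounded minorants\<close>

lemma extended_state_upper:
  "bounded (range y) \<Longrightarrow> (\<And>n. 0 \<le> y n) \<Longrightarrow> (\<And>n. y n \<le> x n) \<Longrightarrow> ennreal (real_state \<omega> y) \<le> extended_state \<omega> x"
  unfolding extended_state_def real_state_def by (rule SUP_upper) simp

lemma extended_state_least:
  "(\<And>y. bounded (range y) \<Longrightarrow> (\<And>n. 0 \<le> y n) \<Longrightarrow> (\<And>n. y n \<le> x n) \<Longrightarrow> ennreal (real_state \<omega> y) \<le> r)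
    \<Longrightarrow> extended_state \<omega> x \<le> r"
  unfolding extended_state_def real_state_def by (rule SUP_least) simp

lemma extended_state_bounded:
  assumes "bounded (range x)" "\<And>n. 0 \<le> x n"
  shows "extended_state \<omega> x = ennreal (real_state \<omega> x)"
proof (rule antisym)
  show "extended_state \<omega> x \<le> ennreal (real_state \<omega> x)"
    by (rule extended_state_least) (intro ennreal_leI real_state_mono assms)
  show "ennreal (real_state \<omega> x) \<le> extended_state \<omega> x"
    by (rule extended_state_upper) (use assms in auto)
qed

lemma extended_state_mono:
  "(\<And>n. x n \<le> y n) \<Longrightarrow> extended_state \<omega> x \<le> extended_state \<omega> y"
  by (rule extended_state_least, rule extended_state_upper) (auto intro: order_trans)

text \<open>Riesz decomposition: a bounded \<open>z\<close> below \<open>x + y\<close> splits into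
  \<open>min z x\<close> and a rest below \<open>y\<close>. Conversely, bounded minorants of
  \<open>x\<close> and \<open>y\<close> can be chosen independently and added.\<close>

lemma extended_state_add:
  assumes "\<And>n. 0 \<le> x n" "\<And>n. 0 \<le> y n"
  shows "extended_state \<omega> (\<lambda>n. x n + y n) = extended_state \<omega> x + extended_state \<omega> y"
proof (rule antisym)
  show "extended_state \<omega> (\<lambda>n. x n + y n) \<le> extended_state \<omega> x + extended_state \<omega> y"
  proof (rule extended_state_least)
    fix z assume z: "bounded (range z)" "\<And>n. 0 \<le> z n" "\<And>n. z n \<le> x n + y n"
    define z1 z2 where "z1 n = min (z n) (x n)" and "z2 n = z n - z1 n" for n
    obtain K where K: "\<And>n. z n \<le> K" using z(1,2) by (auto simp: bounded_iff)
    have z1: "\<And>n. 0 \<le> z1 n" "\<And>n. z1 n \<le> x n" "bounded (range z1)"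
      using assms z(2) K by (auto simp: z1_def min_le_iff_disj intro!: bounded_range_nonneg[of _ K])
    have z2: "\<And>n. 0 \<le> z2 n" "\<And>n. z2 n \<le> y n"
      using z(3) assms by (auto simp: z1_def z2_def min_def algebra_simps)
    have z2b: "bounded (range z2)"
      by (rule bounded_range_nonneg[of z2 K, OF z2(1)]) (metis K z1(1) z2_def diff_ge_0_iff_ge diff_le_eq le_add_same_cancel1 order_trans)
    have "real_state \<omega> z = real_state \<omega> z1 + real_state \<omega> z2"
      using real_state_add[OF z1(3) z2b] by (simp add: z2_def)
    then have "ennreal (real_state \<omega> z) = ennreal (real_state \<omega> z1) + ennreal (real_state \<omega> z2)"
      using state_of_nonneg(2) z1 z2 z2b by (simp add: ennreal_plus)
    also have "\<dots> \<le> extended_state \<omega> x + extended_state \<omega> y"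
      by (intro add_mono extended_state_upper z1 z2 z2b)
    finally show "ennreal (real_state \<omega> z) \<le> extended_state \<omega> x + extended_state \<omega> y" .
  qed
  let ?I = "\<lambda>x. {y :: nat \<Rightarrow> real. bounded (range y) \<and> (\<forall>n. 0 \<le> y n \<and> y n \<le> x n)}"
  have ne: "?I x \<noteq> {}" "?I y \<noteq> {}"
    using assms by (auto intro!: exI[of _ "\<lambda>_. 0"])
  have "extended_state \<omega> x + extended_state \<omega> y =
      (SUP w\<in>?I y. SUP v\<in>?I x. ennreal (real_state \<omega> v) + ennreal (real_state \<omega> w))"
    unfolding extended_state_def real_state_def
    by (simp add: ennreal_SUP_add_left[OF ne(1), symmetric] ennreal_SUP_add_right[OF ne(2)])
  also have "\<dots> \<le> extended_state \<omega> (\<lambda>n. x n + y n)"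
  proof (intro SUP_least)
    fix w v assume "w \<in> ?I y" "v \<in> ?I x"
    then have v: "bounded (range v)" "\<And>n. 0 \<le> v n" "\<And>n. v n \<le> x n"
      and w: "bounded (range w)" "\<And>n. 0 \<le> w n" "\<And>n. w n \<le> y n" by auto
    have "ennreal (real_state \<omega> v) + ennreal (real_state \<omega> w) = ennreal (real_state \<omega> (\<lambda>n. v n + w n))"
      using state_of_nonneg(2) v w by (simp add: real_state_add ennreal_plus)
    also have "\<dots> \<le> extended_state \<omega> (\<lambda>n. x n + y n)"
      using v w by (intro extended_state_upper bounded_range_add add_mono add_nonneg_nonneg)
    finally show "ennreal (real_state \<omega> v) + ennreal (real_state \<omega> w) \<le> extended_state \<omega> (\<lambda>n. x n + y n)" .
  qed
  finally show "extended_state \<omega> x + extended_state \<omega> y \<le> extended_state \<omega> (\<lambda>n. x n + y n)" .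
qed

text \<open>Split at the level \<open>x > K\<close>: by Markov's inequality the exceptional set has state at most
  \<open>\<omega>(x) / K\<close>, and on the rest \<open>x u \<le> K u\<close>.\<close>

lemma extended_state_mult_null:
  assumes u: "\<And>n. 0 \<le> u n" "\<And>n. u n \<le> 1" "real_state \<omega> u = 0"
    and x: "\<And>n. 0 \<le> x n" "extended_state \<omega> x < \<infinity>"
  shows "extended_state \<omega> (\<lambda>n. x n * u n) = 0"
proof -
  have bu: "bounded (range u)" using u(1,2) by (rule bounded_range_nonneg)
  obtain L where L: "extended_state \<omega> x = ennreal L" "0 \<le> L"
    using x(2) by (cases "extended_state \<omega> x") auto
  have "extended_state \<omega> (\<lambda>n. x n * u n) \<le> 0"
  proof (rule extended_state_least)
    fix z assume z: "bounded (range z)" "\<And>n. 0 \<le> z n" "\<And>n. z n \<le> x n * u n"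
    obtain M where M: "\<And>n. z n \<le> M" using z(1,2) by (auto simp: bounded_iff)
    then have M0: "0 \<le> M" using z(2) order_trans by blast
    have "real_state \<omega> z \<le> 0 + \<epsilon>" if "\<epsilon> > 0" for \<epsilon>
    proof -
      \<comment> \<open>Chosen so that \<open>M * L / K \<le> \<epsilon>\<close>; the
        \<open>+ 1\<close> keeps \<open>K\<close> positive when \<open>M * L = 0\<close>.\<close>
      define K where "K = M * L / \<epsilon> + 1"
      have K: "K > 0" using M0 L(2) that by (simp add: K_def add_nonneg_pos)
      define w where "w n = (if x n > K then 1 else 0 :: real)" for n
      have bw: "bounded (range w)" by (rule bounded_range_nonneg[of _ 1]) (auto simp: w_def)
      have "ennreal (real_state \<omega> (\<lambda>n. K * w n)) \<le> extended_state \<omega> x"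
        using K x(1) by (intro extended_state_upper bounded_range_cmult bw) (auto simp: w_def)
      then have Kw: "K * real_state \<omega> w \<le> L" using L by (simp add: real_state_cmult[OF bw])
      have "z n \<le> K * u n + M * w n" for n
      proof (cases "x n > K")
        case True
        then show ?thesis using M[of n] K u(1)[of n] by (simp add: w_def add_increasing)
      next
        case False
        then have "x n * u n \<le> K * u n" using u(1) by (intro mult_right_mono) auto
        then show ?thesis using z(3)[of n] False by (simp add: w_def)
      qed
      then have "real_state \<omega> z \<le> real_state \<omega> (\<lambda>n. K * u n + M * w n)"
        by (intro real_state_mono z(1) bounded_range_add bounded_range_cmult bu bw)
      also have "\<dots> = M * real_state \<omega> w"
        using u(3) by (simp add: real_state_add bounded_range_cmult bu bw real_state_cmult)
      also have "\<dots> \<le> M * (L / K)"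
        using Kw K by (intro mult_left_mono M0) (simp add: field_simps)
      also have "\<dots> \<le> \<epsilon>"
      proof -
        have "M * L \<le> \<epsilon> * K" using that by (simp add: K_def algebra_simps)
        then show ?thesis using K by (simp add: field_simps)
      qed
      finally show ?thesis by simp
    qed
    then have "real_state \<omega> z \<le> 0" by (rule field_le_epsilon)
    then show "ennreal (real_state \<omega> z) \<le> 0" by (simp add: ennreal_neg)
  qed
  then show ?thesis by simp
qed

end

text \<open>For each \<open>\<epsilon> > 0\<close> the sequence is at most \<open>\<epsilon>\<close>
  plus a finitely supported one.\<close>

lemma real_state_null_sequence:
  assumes "singular_state \<omega>" "y \<longlonglongrightarrow> 0" "\<And>n. 0 \<le> y n"
  shows "real_state \<omega> y = 0"
proof -
  have st: "state \<omega>" using assms(1) by (simp add: singular_state_def)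
  have bdd_y: "bounded (range y)" using assms(2) convergent_imp_bounded convergentI by blast
  have "real_state \<omega> y \<le> 0 + \<epsilon>" if \<epsilon>: "\<epsilon> > 0" for \<epsilon>
  proof -
    define f where "f n = (if y n > \<epsilon> then y n else 0)" for n
    have bf: "bounded (range f)"
    proof -
      obtain K where "\<And>n. \<bar>y n\<bar> \<le> K" using bdd_y by (auto simp: bounded_iff)
      then have "\<bar>f n\<bar> \<le> K" for n by (metis abs_ge_zero abs_zero f_def order_trans)
      then show ?thesis by (auto simp: bounded_iff)
    qed
    obtain N where N: "\<And>n. n \<ge> N \<Longrightarrow> y n < \<epsilon>"
      using order_tendstoD(2)[OF assms(2) \<epsilon>] unfolding eventually_sequentially by blast
    have "{n. complex_of_real (f n) \<noteq> 0} \<subseteq> {..<N}"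
      using N by (auto simp: f_def not_less[symmetric] split: if_splits) (meson leI less_asym)
    then have "finite {n. complex_of_real (f n) \<noteq> 0}" using finite_subset by blast
    then have "real_state \<omega> f = 0"
      using assms(1) by (simp add: singular_state_def real_state_def)
    moreover have "real_state \<omega> y \<le> real_state \<omega> (\<lambda>n. \<epsilon> + f n)"
      using \<epsilon> assms(3) by (intro real_state_mono st bdd_y bounded_range_add bf) (auto simp: f_def)
    ultimately show ?thesis
      using real_state_add[OF st _ bf, of "\<lambda>_. \<epsilon>"] real_state_const[OF st] by simp
  qed
  then have "real_state \<omega> y \<le> 0" by (rule field_le_epsilon)
  moreover have "0 \<le> real_state \<omega> y" by (rule state_of_nonneg(2)[OF st bdd_y assms(3)])
  ultimately show ?thesis by simp
qed

lemma real_state_inverse_Suc: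
  assumes "singular_state \<omega>"
  shows "real_state \<omega> (\<lambda>n. 1 / (real n + 1)) = 0"
proof (rule real_state_null_sequence[OF assms])
  show "(\<lambda>n. 1 / (real n + 1)) \<longlonglongrightarrow> 0"
    using LIMSEQ_inverse_real_of_nat by (simp add: inverse_eq_divide add.commute)
qed simp

lemma bounded_range_dilation: "bounded (range y) \<Longrightarrow> bounded (range (dilation k y))"
  by (rule bounded_subset) (auto simp: dilation_def)

lemma real_state_dilation:
  assumes "dilation_invariant \<omega>" "bounded (range y)" "1 \<le> k"
  shows "real_state \<omega> (dilation k y) = real_state \<omega> y"
proof -
  have "\<omega> (dilation k (\<lambda>n. complex_of_real (y n))) = \<omega> (\<lambda>n. complex_of_real (y n))"
    using assms of_real_in_l_infty[OF assms(2)] unfolding dilation_invariant_def by blast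
  then show ?thesis by (simp add: real_state_def dilation_def)
qed

text \<open>Dilating a bounded minorant of \<open>x\<close> gives a bounded minorant of the dilated
  \<open>x\<close> with the same state.\<close>

lemma extended_state_le_dilation:
  assumes "state \<omega>" "dilation_invariant \<omega>" "1 \<le> k"
  shows "extended_state \<omega> x \<le> extended_state \<omega> (dilation k x)"
proof (rule extended_state_least[OF assms(1)])
  fix y assume y: "bounded (range y)" "\<And>n. 0 \<le> y n" "\<And>n. y n \<le> x n"
  have "ennreal (real_state \<omega> (dilation k y)) \<le> extended_state \<omega> (dilation k x)"
    by (intro extended_state_upper[OF assms(1)] bounded_range_dilation y(1)) (simp_all add: dilation_def y)
  then show "ennreal (real_state \<omega> y) \<le> extended_state \<omega> (dilation k x)"
    by (simp only: real_state_dilation[OF assms(2) y(1) assms(3)])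
qed

section \<open>Concave functions and Cesaro means\<close>

context
  fixes \<psi> :: "real \<Rightarrow> real"
  assumes \<psi>: "marcinkiewicz_fun \<psi>"
begin

lemma marcinkiewicz_fun_pos: "0 < t \<Longrightarrow> 0 < \<psi> t"
  using \<psi> by (simp add: marcinkiewicz_fun_def)

lemma marcinkiewicz_fun_mono: "0 \<le> s \<Longrightarrow> s \<le> t \<Longrightarrow> \<psi> s \<le> \<psi> t"
  using \<psi> by (auto simp: marcinkiewicz_fun_def mono_on_def)

lemma marcinkiewicz_fun_concave:
  "0 \<le> x \<Longrightarrow> 0 \<le> y \<Longrightarrow> 0 \<le> t \<Longrightarrow> t \<le> 1 \<Longrightarrow> (1 - t) * \<psi> x + t * \<psi> y \<le> \<psi> ((1 - t) * x + t * y)"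
  using \<psi> concave_onD[of "{0..}" \<psi> t x y] by (simp add: marcinkiewicz_fun_def)

text \<open>Equivalently \<open>\<psi> t / t\<close> is non-increasing: \<open>s\<close> is a convex
  combination of 0 and \<open>t\<close>, and \<open>\<psi> 0 \<ge> 0\<close>.\<close>

lemma marcinkiewicz_fun_le_ratio:
  assumes "0 < s" "s \<le> t"
  shows "\<psi> t \<le> t / s * \<psi> s"
proof -
  have "(1 - s / t) * \<psi> 0 + s / t * \<psi> t \<le> \<psi> ((1 - s / t) * 0 + s / t * t)"
    using assms by (intro marcinkiewicz_fun_concave) auto
  moreover have "0 \<le> (1 - s / t) * \<psi> 0"
    using assms \<psi> by (intro mult_nonneg_nonneg) (auto simp: marcinkiewicz_fun_def)
  ultimately have "s / t * \<psi> t \<le> \<psi> s" using assms by simp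
  then show ?thesis using assms by (simp add: field_simps)
qed

text \<open>The argument is exactly \<open>2 * (n + 1)\<close>: doubling the number of summands from
  \<open>n + 1\<close> changes the normalisation by the factor
  \<open>1 + growth_excess n\<close>.\<close>

definition growth_excess :: "nat \<Rightarrow> real" where
  "growth_excess n = \<psi> (2 * real n + 2) / \<psi> (real n + 1) - 1"

lemma growth_excess_bounds: "0 \<le> growth_excess n" "growth_excess n \<le> 1"
proof -
  have "\<psi> (real n + 1) \<le> \<psi> (2 * real n + 2)" by (rule marcinkiewicz_fun_mono) auto
  then show "0 \<le> growth_excess n" using marcinkiewicz_fun_pos[of "real n + 1"] by (simp add: growth_excess_def)
  have "\<psi> (2 * real n + 2) \<le> (2 * real n + 2) / (real n + 1) * \<psi> (real n + 1)"
    by (rule marcinkiewicz_fun_le_ratio) auto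
  also have "(2 * real n + 2) / (real n + 1) = 2" by (simp add: field_simps)
  finally show "growth_excess n \<le> 1"
    using marcinkiewicz_fun_pos[of "real n + 1"] by (simp add: growth_excess_def field_simps)
qed

text \<open>The ratio in the theorem lies between \<open>1 + u n - 2 / (real n + 1)\<close> and
  \<open>1 + u n\<close>, and the difference is a null sequence.\<close>

lemma state_growth_ratio_eq_1_iff:
  assumes "singular_state \<omega>"
  shows "\<omega> (\<lambda>n. complex_of_real (\<psi> (2 * real n + 1) / \<psi> (real n + 1))) = 1 \<longleftrightarrow>
    real_state \<omega> growth_excess = 0"
proof -
  have st: "state \<omega>" using assms by (simp add: singular_state_def)
  define r where "r n = \<psi> (2 * real n + 1) / \<psi> (real n + 1)" for n
  define u where "u = growth_excess"
  define v where "v = (\<lambda>n. 1 / (real n + 1))"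
  have pos: "0 < \<psi> (real n + 1)" "0 < \<psi> (2 * real n + 1)" for n by (simp_all add: marcinkiewicz_fun_pos)
  have r0: "0 \<le> r n" for n using pos[of n] by (simp add: r_def)
  have r_le: "r n \<le> 1 + u n" for n
    using pos[of n] marcinkiewicz_fun_mono[of "2 * real n + 1" "2 * real n + 2"]
    by (simp add: r_def u_def growth_excess_def divide_right_mono)
  then have r2: "r n \<le> 2" for n using growth_excess_bounds(2)[of n] by (smt (verit) u_def)
  \<comment> \<open>The factor \<open>(2 * n + 2) / (2 * n + 1)\<close> exceeds 1 by at most
    \<open>1 / (n + 1)\<close>, and \<open>r n \<le> 2\<close>.\<close>
  have le_r: "1 + u n \<le> r n + 2 * v n" for n
  proof -
    have "\<psi> (2 * real n + 2) \<le> (2 * real n + 2) / (2 * real n + 1) * \<psi> (2 * real n + 1)"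
      by (rule marcinkiewicz_fun_le_ratio) auto
    then have "\<psi> (2 * real n + 2) / \<psi> (real n + 1) \<le>
        (2 * real n + 2) / (2 * real n + 1) * \<psi> (2 * real n + 1) / \<psi> (real n + 1)"
      by (rule divide_right_mono) (use pos[of n] in simp)
    then have "1 + u n \<le> (2 * real n + 2) / (2 * real n + 1) * r n"
      by (simp add: u_def growth_excess_def r_def)
    also have "\<dots> = r n + 1 / (2 * real n + 1) * r n"
      by (simp add: field_simps)
    also have "\<dots> \<le> r n + v n * 2"
      using r0[of n] r2[of n] by (intro add_left_mono mult_mono) (auto simp: v_def field_simps)
    finally show ?thesis by simp
  qed
  have br: "bounded (range r)" by (rule bounded_range_nonneg[OF r0 r2])
  have bu: "bounded (range u)"
    unfolding u_def by (rule bounded_range_nonneg[OF growth_excess_bounds])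
  have bv: "bounded (range v)" by (rule bounded_range_nonneg[of _ 1]) (auto simp: v_def)
  have b1: "bounded (range (\<lambda>n. 1 + u n))" by (intro bounded_range_add bu) simp
  have b2: "bounded (range (\<lambda>n. r n + 2 * v n))" by (intro bounded_range_add bounded_range_cmult br bv)
  have "real_state \<omega> v = 0" using real_state_inverse_Suc[OF assms] by (simp add: v_def)
  moreover have "real_state \<omega> (\<lambda>n. 1 + u n) = 1 + real_state \<omega> u"
    using real_state_add[OF st _ bu, of "\<lambda>_. 1"] real_state_const[OF st, of 1] by simp
  moreover have "real_state \<omega> (\<lambda>n. r n + 2 * v n) = real_state \<omega> r + 2 * real_state \<omega> v"
    using real_state_add[OF st br bounded_range_cmult[OF bv]] real_state_cmult[OF st bv] by simp
  ultimately have "real_state \<omega> r = 1 + real_state \<omega> u"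
    using real_state_mono[OF st br b1 r_le] real_state_mono[OF st b1 b2 le_r] by simp
  moreover have "\<omega> (\<lambda>n. complex_of_real (r n)) = complex_of_real (real_state \<omega> r)"
    by (rule state_of_nonneg(1)[OF st br r0])
  ultimately have "\<omega> (\<lambda>n. complex_of_real (r n)) = 1 \<longleftrightarrow> real_state \<omega> u = 0"
    by (simp add: complex_eq_iff)
  then show ?thesis unfolding r_def u_def .
qed

section \<open>Comparison of means at nearby and doubled indices\<close>

lemma mean_seq_eq: "mean_seq \<psi> A n = (\<Sum>k<Suc n. \<mu> (real k) A) / \<psi> (real n + 1)"
  by (simp add: mean_seq_def atLeast0AtMost lessThan_Suc_atMost)

lemma mean_seq_nonneg: "0 \<le> mean_seq \<psi> A n"
  unfolding mean_seq_eq using marcinkiewicz_fun_pos[of "real n + 1"]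
  by (intro divide_nonneg_pos sum_nonneg mu_nonneg) simp

text \<open>The added singular value is at most the average of the preceding \<open>n + 1\<close>,
  and the denominator does not decrease.\<close>

lemma mean_seq_Suc_le: "mean_seq \<psi> A (Suc n) \<le> mean_seq \<psi> A n * (1 + 1 / (real n + 1))"
proof -
  let ?S = "\<lambda>n. \<Sum>k<n. \<mu> (real k) A"
  have pos: "0 < \<psi> (real n + 1)" by (rule marcinkiewicz_fun_pos) simp
  have "real (Suc n) * \<mu> (real (Suc n)) A = (\<Sum>k<Suc n. \<mu> (real (Suc n)) A)" by simp
  also have "\<dots> \<le> ?S (Suc n)" by (intro sum_mono mu_antimono) simp
  finally have "\<mu> (real (Suc n)) A \<le> ?S (Suc n) * (1 / (real n + 1))" by (simp add: field_simps)
  then have S: "?S (Suc (Suc n)) \<le> ?S (Suc n) * (1 + 1 / (real n + 1))"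
    by (simp only: sum.lessThan_Suc[of _ "Suc n"] distrib_left mult_1_right add_left_mono)
  have "mean_seq \<psi> A (Suc n) \<le> ?S (Suc (Suc n)) / \<psi> (real n + 1)"
    unfolding mean_seq_eq
    using pos marcinkiewicz_fun_mono[of "real n + 1" "real (Suc n) + 1"]
    by (intro divide_left_mono sum_nonneg mu_nonneg mult_pos_pos marcinkiewicz_fun_pos) auto
  also have "\<dots> \<le> ?S (Suc n) * (1 + 1 / (real n + 1)) / \<psi> (real n + 1)"
    using S pos by (intro divide_right_mono) auto
  finally show ?thesis by (simp add: mean_seq_eq)
qed

text \<open>The numerator does not decrease, and \<open>\<psi>\<close> grows at most in proportion
  to its argument.\<close>

lemma mean_seq_le_Suc: "mean_seq \<psi> A n \<le> mean_seq \<psi> A (Suc n) * (1 + 1 / (real n + 1))"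
proof -
  let ?S = "\<lambda>n. \<Sum>k<n. \<mu> (real k) A"
  have pos: "0 < \<psi> (real n + 1)" "0 < \<psi> (real n + 2)" by (simp_all add: marcinkiewicz_fun_pos)
  have "\<psi> (real n + 2) \<le> (real n + 2) / (real n + 1) * \<psi> (real n + 1)"
    by (rule marcinkiewicz_fun_le_ratio) auto
  also have "(real n + 2) / (real n + 1) = 1 + 1 / (real n + 1)" by (simp add: field_simps)
  finally have "\<psi> (real n + 2) \<le> (1 + 1 / (real n + 1)) * \<psi> (real n + 1)" .
  moreover have "1 / y \<le> q / x" if "x \<le> q * y" "0 < x" "0 < y" for x y q :: real
    using that by (simp add: field_simps)
  ultimately have *: "1 / \<psi> (real n + 1) \<le> (1 + 1 / (real n + 1)) / \<psi> (real n + 2)"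
    using pos by blast
  have "mean_seq \<psi> A n \<le> ?S (Suc (Suc n)) * (1 / \<psi> (real n + 1))"
    using pos mu_nonneg[of "real (Suc n)" A] unfolding mean_seq_eq by (simp add: divide_right_mono)
  also have "\<dots> \<le> ?S (Suc (Suc n)) * ((1 + 1 / (real n + 1)) / \<psi> (real n + 2))"
    by (intro mult_left_mono * sum_nonneg mu_nonneg)
  also have "\<dots> = mean_seq \<psi> A (Suc n) * (1 + 1 / (real n + 1))"
  proof -
    have "real (Suc n) + 1 = real n + 2" by simp
    then show ?thesis by (simp only: mean_seq_eq) simp
  qed
  finally show ?thesis .
qed

text \<open>The index \<open>2 * (k div 2) + 1\<close> is \<open>k\<close> for odd \<open>k\<close>
  and \<open>k + 1\<close> for even \<open>k\<close>.\<close>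

lemma dilation_odd_mean_seq_le:
  "dilation 2 (\<lambda>n. mean_seq \<psi> A (2 * n + 1)) k \<le> mean_seq \<psi> A k * (1 + 1 / (real k + 1))"
proof (cases "even k")
  case True
  then show ?thesis using mean_seq_Suc_le[of A k] by (simp add: dilation_def)
next
  case False
  then have "2 * (k div 2) + 1 = k" by simp
  then show ?thesis using mean_seq_nonneg[of A k] by (simp add: dilation_def distrib_left)
qed

lemma mean_seq_le_dilation_odd:
  "mean_seq \<psi> A k \<le> dilation 2 (\<lambda>n. mean_seq \<psi> A (2 * n + 1)) k * (1 + 1 / (real k + 1))"
proof (cases "even k")
  case True
  then show ?thesis using mean_seq_le_Suc[of A k] by (simp add: dilation_def)
next
  case False
  then have "2 * (k div 2) + 1 = k" by simp
  then show ?thesis using mean_seq_nonneg[of A k] by (simp add: dilation_def distrib_left)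
qed

lemma mean_seq_subadditive:
  fixes A B :: "'a::complex_hilbert_space oper"
  assumes "separable TYPE('a)" "infinite_dimensional TYPE('a)" "positive_op A" "positive_op B"
  shows "mean_seq \<psi> (A + B) n \<le> mean_seq \<psi> A n + mean_seq \<psi> B n"
  using sum_mu_subadditive[OF assms, of "Suc n"] marcinkiewicz_fun_pos[of "real n + 1"]
  unfolding mean_seq_eq by (simp add: divide_right_mono flip: add_divide_distrib)

lemma mean_seq_superadditive:
  fixes A B :: "'a::complex_hilbert_space oper"
  assumes "separable TYPE('a)" "infinite_dimensional TYPE('a)" "positive_op A" "positive_op B"
  shows "mean_seq \<psi> A n + mean_seq \<psi> B n \<le> mean_seq \<psi> (A + B) (2 * n + 1) * (1 + growth_excess n)"
proof -
  have pos: "0 < \<psi> (real n + 1)" "0 < \<psi> (2 * real n + 2)" by (simp_all add: marcinkiewicz_fun_pos)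
  have "mean_seq \<psi> A n + mean_seq \<psi> B n \<le> (\<Sum>k<2 * Suc n. \<mu> (real k) (A + B)) / \<psi> (real n + 1)"
    using sum_mu_superadditive[OF assms, of "Suc n"] pos
    unfolding mean_seq_eq add_divide_distrib[symmetric] by (intro divide_right_mono) auto
  also have "\<dots> = mean_seq \<psi> (A + B) (2 * n + 1) * (1 + growth_excess n)"
  proof -
    have "real (2 * n + 1) + 1 = 2 * real n + 2" "Suc (2 * n + 1) = 2 * Suc n" by simp_all
    then show ?thesis using pos by (simp only: mean_seq_eq growth_excess_def) simp
  qed
  finally show ?thesis .
qed

text \<open>The increments of \<open>\<psi>\<close>, with the first one replaced by \<open>\<psi>(1)\<close> since \<open>\<psi>\<close> need not vanish at \<open>0\<close>.\<close>

definition increments :: "nat \<Rightarrow> real" where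
  "increments k = (if k = 0 then \<psi> 1 else \<psi> (real k + 1) - \<psi> (real k))"

lemma increments_nonneg: "0 \<le> increments k"
  using marcinkiewicz_fun_pos[of 1] by (auto simp: increments_def intro: marcinkiewicz_fun_mono)

lemma decseq_increments: "decseq increments"
  unfolding decseq_Suc_iff
proof
  fix k
  have "(1 - 1 / 2) * \<psi> (real k) + 1 / 2 * \<psi> (real k + 2) \<le> \<psi> ((1 - 1 / 2) * real k + 1 / 2 * (real k + 2))"
    by (rule marcinkiewicz_fun_concave) auto
  also have "(1 - 1 / 2) * real k + 1 / 2 * (real k + 2) = real k + 1" by (simp add: field_simps)
  finally have "\<psi> (real k + 2) - \<psi> (real k + 1) \<le> \<psi> (real k + 1) - \<psi> (real k)" by simp
  \<comment> \<open>This settles \<open>k = 0\<close>, where \<open>increments 0\<close> is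
    \<open>\<psi> 1\<close> instead of \<open>\<psi> 1 - \<psi> 0\<close>.\<close>
  moreover have "0 \<le> \<psi> 0" using \<psi> by (simp add: marcinkiewicz_fun_def)
  ultimately show "increments (Suc k) \<le> increments k"
    by (cases k) (auto simp: increments_def add.commute)
qed

lemma sum_increments: "(\<Sum>k<Suc n. increments k) = \<psi> (real n + 1)"
  by (induction n) (simp_all add: increments_def add.commute)

lemma sum_increments_double: "(\<Sum>k<2 * n. increments (k div 2)) = 2 * (\<Sum>k<n. increments k)"
  by (induction n) simp_all

end

theorem theorem4p6:
  fixes \<E> :: "('a::complex_hilbert_space) oper set"
    and norm_\<E> :: "'a oper \<Rightarrow> real"
    and \<psi> :: "real \<Rightarrow> real"
    and \<omega> :: "(nat \<Rightarrow> complex) \<Rightarrow> complex"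
  assumes "separable TYPE('a)"
    and "infinite_dimensional TYPE('a)"
    and "symmetric_operator_ideal \<E> norm_\<E>"
    and "marcinkiewicz_fun \<psi>"
    and "marcinkiewicz_ideal \<psi> \<subseteq> \<E>"
    and "singular_state \<omega>"
    and "dilation_invariant \<omega>"
    and "\<forall>A\<in>positive_cone \<E>. \<tau> \<omega> \<psi> A < \<infinity>"
  shows "(\<forall>A\<in>positive_cone \<E>. \<forall>B\<in>positive_cone \<E>. \<tau> \<omega> \<psi> (A + B) = \<tau> \<omega> \<psi> A + \<tau> \<omega> \<psi> B)
    \<longleftrightarrow> \<omega> (\<lambda>n. complex_of_real (\<psi> (2 * real n + 1) / \<psi> (real n + 1))) = 1"
proof -
  note sep = assms(1) and inf_dim = assms(2) and \<psi> = assms(4)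
  have st: "state \<omega>" using assms(6) by (simp add: singular_state_def)
  define u where "u = growth_excess \<psi>"
  define v where "v = (\<lambda>n. 1 / (real n + 1))"
  have u: "\<And>n. 0 \<le> u n" "\<And>n. u n \<le> 1"
    unfolding u_def by (rule growth_excess_bounds[OF \<psi>])+
  have v: "\<And>n. 0 \<le> v n" "\<And>n. v n \<le> 1" "real_state \<omega> v = 0"
    using real_state_inverse_Suc[OF assms(6)] by (simp_all add: v_def)
  have bu: "bounded (range u)" and bv: "bounded (range v)"
    using bounded_range_nonneg[OF u] bounded_range_nonneg[OF v(1,2)] by auto
  have "(\<forall>A\<in>positive_cone \<E>. \<forall>B\<in>positive_cone \<E>. \<tau> \<omega> \<psi> (A + B) = \<tau> \<omega> \<psi> A + \<tau> \<omega> \<psi> B)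
    \<longleftrightarrow> real_state \<omega> u = 0"
  proof (intro iffI ballI)
    fix A B assume u0: "real_state \<omega> u = 0" and AB: "A \<in> positive_cone \<E>" "B \<in> positive_cone \<E>"
    then have pos: "positive_op A" "positive_op B" by (auto simp: positive_cone_def)
    have "A + B \<in> positive_cone \<E>"
      using AB assms(3) positive_op_add[OF pos]
      by (auto simp: positive_cone_def symmetric_operator_ideal_def two_sided_ideal_def)
    then have fin: "\<tau> \<omega> \<psi> (A + B) < \<infinity>" using assms(8) by blast
    define x where "x = mean_seq \<psi> (A + B)"
    define x' where "x' = (\<lambda>n. x (2 * n + 1))"
    note mean_nonneg = mean_seq_nonneg[OF \<psi>]
    have x0: "0 \<le> x n" "0 \<le> x' n" for n by (simp_all add: x_def x'_def mean_nonneg)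
    have \<tau>x: "\<tau> \<omega> \<psi> (A + B) = extended_state \<omega> x" by (simp add: \<tau>_def x_def)
    have sum: "\<tau> \<omega> \<psi> A + \<tau> \<omega> \<psi> B = extended_state \<omega> (\<lambda>n. mean_seq \<psi> A n + mean_seq \<psi> B n)"
      by (simp add: \<tau>_def extended_state_add[OF st] mean_nonneg)
    have "extended_state \<omega> x' \<le> extended_state \<omega> (dilation 2 x')"
      by (rule extended_state_le_dilation[OF st assms(7)]) simp
    also have "\<dots> \<le> extended_state \<omega> (\<lambda>n. x n + x n * v n)"
      using dilation_odd_mean_seq_le[OF \<psi>, of "A + B"]
      by (intro extended_state_mono[OF st]) (simp add: x_def x'_def v_def distrib_left)
    also have "\<dots> = extended_state \<omega> x + extended_state \<omega> (\<lambda>n. x n * v n)"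
      by (rule extended_state_add[OF st]) (simp_all add: x0 v)
    also have "\<dots> = extended_state \<omega> x"
      using extended_state_mult_null[OF st v x0(1)] fin \<tau>x by simp
    finally have x'x: "extended_state \<omega> x' \<le> extended_state \<omega> x" .
    have "\<tau> \<omega> \<psi> A + \<tau> \<omega> \<psi> B \<le> extended_state \<omega> (\<lambda>n. x' n + x' n * u n)"
      unfolding sum using mean_seq_superadditive[OF \<psi> sep inf_dim pos]
      by (intro extended_state_mono[OF st]) (simp add: x_def x'_def u_def distrib_left)
    also have "\<dots> = extended_state \<omega> x' + extended_state \<omega> (\<lambda>n. x' n * u n)"
      by (rule extended_state_add[OF st]) (simp_all add: x0 u)
    \<comment> \<open>The preceding chain made the extended state finite at \<open>x'\<close>, which
      is what allows dropping the \<open>u\<close> term for a possibly unbounded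
      \<open>x'\<close>.\<close>
    also have "\<dots> = extended_state \<omega> x'"
      using extended_state_mult_null[OF st u u0 x0(2)] x'x fin \<tau>x by simp
    finally have "\<tau> \<omega> \<psi> A + \<tau> \<omega> \<psi> B \<le> \<tau> \<omega> \<psi> (A + B)" using x'x \<tau>x by simp
    moreover have "\<tau> \<omega> \<psi> (A + B) \<le> \<tau> \<omega> \<psi> A + \<tau> \<omega> \<psi> B"
      unfolding sum unfolding \<tau>_def
      by (intro extended_state_mono[OF st] mean_seq_subadditive[OF \<psi> sep inf_dim pos])
    ultimately show "\<tau> \<omega> \<psi> (A + B) = \<tau> \<omega> \<psi> A + \<tau> \<omega> \<psi> B" by simp
  next
    assume additive: "\<forall>A\<in>positive_cone \<E>. \<forall>B\<in>positive_cone \<E>. \<tau> \<omega> \<psi> (A + B) = \<tau> \<omega> \<psi> A + \<tau> \<omega> \<psi> B"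
    obtain c :: "nat \<Rightarrow> 'a" where c: "orthonormal (range c)" "inj c"
      using exists_orthonormal_sequence[OF inf_dim] by blast
    define a where "a = increments \<psi>"
    have a: "decseq a" "\<And>n. 0 \<le> a n"
      unfolding a_def by (rule decseq_increments[OF \<psi>], rule increments_nonneg[OF \<psi>])
    have pos: "0 < \<psi> (real n + 1)" "0 < \<psi> (2 * real n + 2)" for n by (simp_all add: marcinkiewicz_fun_pos[OF \<psi>])
    have diag: "positive_op (diag_op d a) \<and> mean_seq \<psi> (diag_op d a) n = 1"
      if "orthonormal (range d)" "inj d" for d :: "nat \<Rightarrow> 'a" and n
      using positive_op_diag_op[OF that a] pos(1)[of n] sum_increments[OF \<psi>, of n, folded a_def]
      by (simp only: mean_seq_eq[OF \<psi>] mu_diag_op[OF that a sep]) simp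
    define A where "A = diag_op (\<lambda>j. c (2 * j)) a"
    define B where "B = diag_op (\<lambda>j. c (2 * j + 1)) a"
    have "orthonormal (range (\<lambda>j. c (2 * j)))" "orthonormal (range (\<lambda>j. c (2 * j + 1)))"
      using c(1) by (auto intro: orthonormal_subset)
    moreover have "inj (\<lambda>j. c (2 * j))" "inj (\<lambda>j. c (2 * j + 1))"
      using c(2) by (auto simp: inj_eq intro!: injI)
    ultimately have A: "positive_op A" "\<And>n. mean_seq \<psi> A n = 1" and B: "positive_op B" "\<And>n. mean_seq \<psi> B n = 1"
      unfolding A_def B_def using diag by blast+
    \<comment> \<open>The inclusion of the Marcinkiewicz ideal in \<open>\<E>\<close> makes these
      test operators available to the additivity hypothesis.\<close>
    have "A \<in> marcinkiewicz_ideal \<psi>" "B \<in> marcinkiewicz_ideal \<psi>"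
      using A B by (auto simp: marcinkiewicz_ideal_def positive_op_def)
    then have cone: "A \<in> positive_cone \<E>" "B \<in> positive_cone \<E>"
      using assms(5) A(1) B(1) by (auto simp: positive_cone_def)
    define x where "x = mean_seq \<psi> (A + B)"
    define x' where "x' = (\<lambda>n. x (2 * n + 1))"
    have x0: "0 \<le> x n" "0 \<le> x' n" for n by (simp_all add: x_def x'_def mean_seq_nonneg[OF \<psi>])
    have x2: "x n \<le> 2" for n
      using mean_seq_subadditive[OF \<psi> sep inf_dim A(1) B(1), of n] by (simp add: x_def A B)
    then have x'2: "x' n \<le> 2" for n by (simp add: x'_def)
    have bx: "bounded (range x)" and bx': "bounded (range x')"
      using bounded_range_nonneg[OF x0(1) x2] bounded_range_nonneg[OF x0(2) x'2] by auto
    have one: "\<tau> \<omega> \<psi> T = 1" if "\<And>n. mean_seq \<psi> T n = 1" for T :: "'a oper"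
    proof -
      have "mean_seq \<psi> T = (\<lambda>_. 1)" using that by blast
      then show ?thesis using extended_state_bounded[OF st, of "\<lambda>_. 1"] real_state_const[OF st, of 1]
        by (simp add: \<tau>_def)
    qed
    have "ennreal (real_state \<omega> x) = \<tau> \<omega> \<psi> (A + B)"
      unfolding \<tau>_def x_def[symmetric] by (rule extended_state_bounded[OF st bx x0(1), symmetric])
    also have "\<dots> = \<tau> \<omega> \<psi> A + \<tau> \<omega> \<psi> B" using additive cone by blast
    also have "\<dots> = ennreal 2" using one[of A] one[of B] A B by (simp flip: ennreal_numeral)
    finally have rx: "real_state \<omega> x = 2"
      using state_of_nonneg(2)[OF st bx x0(1)] by (simp only: ennreal_inj zero_le_numeral)
    have AB: "A + B = diag_op c (\<lambda>j. a (j div 2))"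
      unfolding A_def B_def by (rule diag_op_add_even_odd[OF c a])
    have "decseq (\<lambda>j. a (j div 2))" using a(1) by (simp add: decseq_def div_le_mono)
    then have "\<mu> (real k) (A + B) = a (k div 2)" for k
      unfolding AB by (rule mu_diag_op[OF c _ a(2) sep])
    \<comment> \<open>The first \<open>2 * n + 2\<close> singular values of the sum are the first
      \<open>n + 1\<close> increments, each taken twice.\<close>
    then have x': "x' n = 2 / (1 + u n)" for n
    proof -
      have "(\<Sum>k<Suc (2 * n + 1). \<mu> (real k) (A + B)) = 2 * \<psi> (real n + 1)"
        using \<open>\<And>k. \<mu> (real k) (A + B) = a (k div 2)\<close> sum_increments_double[OF \<psi>, of "Suc n"]
          sum_increments[OF \<psi>, of n] by (simp add: a_def)
      then show ?thesis using pos[of n]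
        unfolding x'_def x_def mean_seq_eq[OF \<psi>]
        by (simp add: u_def growth_excess_def[OF \<psi>] add.commute)
    qed
    have "x k \<le> dilation 2 x' k + 2 * v k" for k
    proof -
      have "x k \<le> dilation 2 x' k * (1 + v k)"
        using mean_seq_le_dilation_odd[OF \<psi>, of "A + B" k] by (simp add: x_def x'_def v_def)
      also have "\<dots> \<le> dilation 2 x' k + 2 * v k"
        using x'2[of "k div 2"] v(1)[of k] by (simp add: distrib_left dilation_def mult_right_mono)
      finally show ?thesis .
    qed
    then have "real_state \<omega> x \<le> real_state \<omega> (\<lambda>k. dilation 2 x' k + 2 * v k)"
      by (intro real_state_mono[OF st] bx bounded_range_add bounded_range_dilation bx' bounded_range_cmult bv)
    also have "\<dots> = real_state \<omega> x'"
      using real_state_dilation[OF assms(7) bx', of 2] v(3)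
      by (simp add: real_state_add[OF st bounded_range_dilation[OF bx'] bounded_range_cmult[OF bv]]
          real_state_cmult[OF st bv])
    finally have rx': "2 \<le> real_state \<omega> x'" using rx by simp
    \<comment> \<open>After clearing denominators this is \<open>u n * u n \<le> u n\<close>. Since
      the state of \<open>x'\<close> is at least 2, it leaves no room for a positive state of
      \<open>u\<close>.\<close>
    have "u n + x' n \<le> 2" for n
    proof -
      have "u n * u n \<le> u n" using u[of n] by (simp add: mult_left_le)
      then show ?thesis using u[of n] unfolding x' by (simp add: field_simps)
    qed
    then have "real_state \<omega> (\<lambda>n. u n + x' n) \<le> real_state \<omega> (\<lambda>_. 2)"
      by (intro real_state_mono[OF st] bounded_range_add bu bx') auto
    then have "real_state \<omega> u \<le> 0"
      using rx' by (simp add: real_state_add[OF st bu bx'] real_state_const[OF st])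
    moreover have "0 \<le> real_state \<omega> u" by (rule state_of_nonneg(2)[OF st bu u(1)])
    ultimately show "real_state \<omega> u = 0" by simp
  qed
  then show ?thesis using state_growth_ratio_eq_1_iff[OF \<psi> assms(6)] by (simp add: u_def)
qed

end
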